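(* Let $F$ be a field of characteristic zero. (1) Fix integers $r>0$ and $n\ge0$. Whenever $d$ is a sufficiently large integer ($d\ge 2n+r$ certainly suffices, although this bound is not sharp), $\omega_n^r(d)=C_n^r(d)$. In other words, when $d$ is a sufficiently large integer, the map $f(\omega_n^r(d)):V_d^{\otimes n}\to V_d^{\otimes n}$ is given by the action of $\Omega_{r,d}\in FS_d$. (2) Fix $t\in F$ and an integer $r>0$. The morphisms $\omega_n^r(t):[n]\to[n]$, for each nonnegative integer $n$, form an endomorphism of the identity functor on $\underline{\mathrm{Rep}}_0(S_t;F)$. In particular, $\omega_n^r(t)$ is in the center of $FP_n(t)$ for every $t\in F$ and integer $n\ge 0$.
   Context: The category. For $n,m\ge 0$ let $P_{n,m}$ be the set of all set partitions of $\{1,\ldots,n,1',\ldots,m'\}$ ($P_{0,0}$ consists of the empty partition), and $FP_{n,m}$ the $F$-vector space with basis $P_{n,m}$. For $\pi\in P_{n,m}$, $\mu\in P_{m,l}$, let $\mu\star\pi$ be the partition of $\{1,\ldots,n,1'',\ldots,m'',1',\ldots,l'\}$ obtained by identifying the vertex $j'$ of $\pi$ with the vertex $j$ of $\mu$, renamed $j''$, and taking connected components of the glued graph; $\ell(\mu,\pi)$ is the number of parts of $\mu\star\pi$ consisting only of doubly primed elements, and $\mu\cdot\pi\in P_{n,l}$ is the restriction of $\mu\star\pi$ to $\{1,\ldots,n,1',\ldots,l'\}$. For $t\in F$, the category $\underline{\mathrm{Rep}}_0(S_t;F)$ has objects $[n]$ ($n\ge 0$), $\mathrm{Hom}([n],[m])=FP_{n,m}$,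 and bilinear composition with $\mu\circ\pi=t^{\ell(\mu,\pi)}\,\mu\cdot\pi$. Write $FP_n(t)=\mathrm{End}([n])$. The basis $x_\pi$. Order $P_{n,m}$ by $\pi\le\mu$ if $\mu$ is coarser than $\pi$; define inductively $x_\pi=\pi-\sum_{\mu>\pi}x_\mu$ (sum over strictly coarser $\mu$). The $x_\pi$ form a basis of $FP_{n,m}$. The map $f$. For an integer $d\ge0$ let $V_d$ be the permutation representation of $S_d$ with basis $v_1,\ldots,v_d$; let $[n,d]$ be the set of functions $\mathbf{i}:\{1,\ldots,n\}\to\{1,\ldots,d\}$, $j\mapsto i_j$, and $v_{\mathbf{i}}=v_{i_1}\otimes\cdots\otimes v_{i_n}$ (and $V_d^{\otimes 0}=F$). For $\mathbf{i}\in[n,d]$, $\mathbf{i}'\in[m,d]$ color the vertex $j$ of $\pi\in P_{n,m}$ by $i_j$ and $j'$ by $i'_j$; the coloring is good if vertices in the same part have the same color, and perfect if vertices have the same color exactly when they are in the same part. The linear map $f:FP_{n,m}\to\mathrm{Hom}_{S_d}(V_d^{\otimes n},V_d^{\otimes m})$ is given by $f(\pi)(v_{\mathbf{i}})=\sum v_{\mathbf{i}'}$, summed over the $\mathbf{i}'\in[m,d]$ for which the $(\mathbf{i},\mathbf{i}')$-coloring of $\pi$ is good; it is an isomorphism when $d\ge n+m$. For positive integers $r\le d$, $\Omega_{r,d}\in FS_d$ is the sum of all $r$-cycles in $S_d$. For $r\le d$ and $2n\le d$, $C_n^r(d)\in FP_n(d)$ is the unique element such that $f(C_n^r(d))$ is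 the action of $\Omega_{r,d}$ on $V_d^{\otimes n}$. The elements $\omega_n^r(t)$. For $\pi\in P_{n,n}$ let $a$ be the number of parts of $\pi$; $b$ the number of parts containing both $j$ and $j'$ for some $1\le j\le n$; $c$ the number of connected components of the graph obtained from a diagram of $\pi$ by additionally joining $j$ to $j'$ for every $1\le j\le n$. For positive integers $r\le d$ and $\mathbf{i},\mathbf{i}'\in[n,d]$ such that the $(\mathbf{i},\mathbf{i}')$-coloring of $\pi$ is perfect, let $S(\pi,r,d)$ be the number of $r$-cycles $\sigma\in S_d$ with $\sigma(i_j)=i'_j$ for all $1\le j\le n$ (independent of the choice of perfect coloring). For $t\in F$ and integers $r>0$, $n\ge 0$, set $\omega_n^r(t)=\sum_{\pi\in P_{n,n}}q_{\pi,r,t}\,x_\pi\in FP_n(t)$, where $q_{\pi,r,t}=0$ if $S(\pi,r,d)=0$ for all integers $d>1$ (for which it is defined), and otherwise $$q_{\pi,r,t}=\frac{(r-a+c-1)!}{(r-a+b)!}\prod_{k=1}^{r+b-a}(t-r-b+k)$$ (an empty product is $1$).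
   Formalization: An r-cycle is a permutation with exactly one nontrivial orbit, of size r, so there are no 1-cycles and the case r=1 reads 0=0; with the identity as 1-cycle the claim fails for r=1, since ω_0^1(t)=t and ω_1^1(t)=t−1. *)

theory Defs
  imports
    Complex_Main
    "HOL-Library.FuncSet"
    "HOL-Library.Disjoint_Sets"
    "HOL-Combinatorics.Orbits"
begin

section \<open>Partition diagrams\<close>

(* Unprimed j stands for j, Primed j for j', Doubly j for j''. *)
datatype vertex = Unprimed nat | Primed nat | Doubly nat

type_synonym diagram = "vertex set set"

definition vertices :: "nat \<Rightarrow> nat \<Rightarrow> vertex set" where
  "vertices n m = Unprimed ` {1..n} \<union> Primed ` {1..m}"

definition P :: "nat \<Rightarrow> nat \<Rightarrow> diagram set" where
  "P n m = {\<pi>. partition_on (vertices n m) \<pi>}"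

(* The connected components of the graph on \<Union>\<E> in which two vertices are adjacent
   iff some member of \<E> contains both. The members of \<E> may be edges {x, y} or parts of
   a partition; a part contributes the complete graph on its elements. *)
definition components_of :: "vertex set set \<Rightarrow> vertex set set" where
  "components_of \<E> = (\<Union>\<E>) // {(x, y). \<exists>B\<in>\<E>. x \<in> B \<and> y \<in> B}\<^sup>*"

fun glue_top :: "vertex \<Rightarrow> vertex" where
  "glue_top (Unprimed j) = Unprimed j"
| "glue_top (Primed j) = Doubly j"
| "glue_top (Doubly j) = Doubly j"

fun glue_bottom :: "vertex \<Rightarrow> vertex" where
  "glue_bottom (Unprimed j) = Doubly j"
| "glue_bottom (Primed j) = Primed j"
| "glue_bottom (Doubly j) = Doubly j"

definition star :: "diagram \<Rightarrow> diagram \<Rightarrow> diagram" where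
  "star \<mu> \<pi> = components_of (image glue_top ` \<pi> \<union> image glue_bottom ` \<mu>)"

definition loops :: "diagram \<Rightarrow> diagram \<Rightarrow> nat" where
  "loops \<mu> \<pi> = card {B \<in> star \<mu> \<pi>. B \<subseteq> range Doubly}"

definition dot :: "diagram \<Rightarrow> diagram \<Rightarrow> diagram" where
  "dot \<mu> \<pi> = (\<lambda>B. B - range Doubly) ` star \<mu> \<pi> - {{}}"


section \<open>The category\<close>

(* Vectors with respect to a finite basis X are coefficient functions vanishing off X. *)
definition span_on :: "'b set \<Rightarrow> ('b \<Rightarrow> 'a::field_char_0) set" where
  "span_on X = {g. \<forall>x. x \<notin> X \<longrightarrow> g x = 0}"

definition basis_vec :: "'b \<Rightarrow> 'b \<Rightarrow> 'a::field_char_0" where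
  "basis_vec x = (\<lambda>y. if y = x then 1 else 0)"

definition FP :: "nat \<Rightarrow> nat \<Rightarrow> (diagram \<Rightarrow> 'a::field_char_0) set" where
  "FP n m = span_on (P n m)"

(* comp_of C x y z g h is the composite of h : x \<rightarrow> y followed by g : y \<rightarrow> z. *)
record ('o, 'm) category_data =
  objects :: "'o set"
  hom_of :: "'o \<Rightarrow> 'o \<Rightarrow> 'm set"
  comp_of :: "'o \<Rightarrow> 'o \<Rightarrow> 'o \<Rightarrow> 'm \<Rightarrow> 'm \<Rightarrow> 'm"
  ident_of :: "'o \<Rightarrow> 'm"

record ('o, 'm, 'p, 'n) functor_data =
  on_objects :: "'o \<Rightarrow> 'p"
  on_homs :: "'o \<Rightarrow> 'o \<Rightarrow> 'm \<Rightarrow> 'n"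

definition identity_functor :: "('o, 'm, 'o, 'm) functor_data" where
  "identity_functor = \<lparr>on_objects = (\<lambda>x. x), on_homs = (\<lambda>x y g. g)\<rparr>"

definition natural_transformation ::
  "('o, 'm) category_data \<Rightarrow> ('p, 'n) category_data \<Rightarrow>
   ('o, 'm, 'p, 'n) functor_data \<Rightarrow> ('o, 'm, 'p, 'n) functor_data \<Rightarrow> ('o \<Rightarrow> 'n) \<Rightarrow> bool" where
  "natural_transformation C D S T \<eta> \<longleftrightarrow>
     (\<forall>x\<in>objects C. \<eta> x \<in> hom_of D (on_objects S x) (on_objects T x)) \<and>
     (\<forall>x\<in>objects C. \<forall>y\<in>objects C. \<forall>g\<in>hom_of C x y.
        comp_of D (on_objects S x) (on_objects S y) (on_objects T y) (\<eta> y) (on_homs S x y g) =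
        comp_of D (on_objects S x) (on_objects T x) (on_objects T y) (on_homs T x y g) (\<eta> x))"

definition endomorphism_of_identity :: "('o, 'm) category_data \<Rightarrow> ('o \<Rightarrow> 'm) \<Rightarrow> bool" where
  "endomorphism_of_identity C \<eta> \<longleftrightarrow>
     natural_transformation C C identity_functor identity_functor \<eta>"

definition center_of_End :: "('o, 'm) category_data \<Rightarrow> 'o \<Rightarrow> 'm set" where
  "center_of_End C x =
     {z \<in> hom_of C x x. \<forall>g\<in>hom_of C x x. comp_of C x x x z g = comp_of C x x x g z}"

definition Rep0_comp :: "'a::field_char_0 \<Rightarrow> nat \<Rightarrow> nat \<Rightarrow> nat \<Rightarrow>
    (diagram \<Rightarrow> 'a) \<Rightarrow> (diagram \<Rightarrow> 'a) \<Rightarrow> (diagram \<Rightarrow> 'a)" where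
  "Rep0_comp t n m l g h =
     (\<lambda>\<rho>. \<Sum>\<mu>\<in>P m l. \<Sum>\<pi>\<in>P n m. g \<mu> * h \<pi> * (t ^ loops \<mu> \<pi> * basis_vec (dot \<mu> \<pi>) \<rho>))"

definition Rep0 :: "'a::field_char_0 \<Rightarrow> (nat, diagram \<Rightarrow> 'a) category_data" where
  "Rep0 t =
     \<lparr>objects = UNIV,
      hom_of = FP,
      comp_of = Rep0_comp t,
      ident_of = (\<lambda>n. basis_vec ((\<lambda>j. {Unprimed j, Primed j}) ` {1..n}))\<rparr>"


section \<open>The basis $x_\pi$\<close>

definition strictly_coarser :: "nat \<Rightarrow> nat \<Rightarrow> diagram \<Rightarrow> diagram set" where
  "strictly_coarser n m \<pi> = {\<mu> \<in> P n m. refines (vertices n m) \<pi> \<mu> \<and> \<pi> \<noteq> \<mu>}"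

lemma finite_P: "finite (P n m)"
  unfolding P_def vertices_def by (intro finitely_many_partition_on) auto

lemma strictly_coarser_psubset:
  assumes "\<mu> \<in> strictly_coarser n m \<pi>"
  shows "strictly_coarser n m \<mu> \<subset> strictly_coarser n m \<pi>"
proof -
  have "strictly_coarser n m \<mu> \<subseteq> strictly_coarser n m \<pi>"
    using assms unfolding strictly_coarser_def by (auto intro: refines_trans dest: refines_asym)
  moreover have "\<mu> \<notin> strictly_coarser n m \<mu>"
    by (simp add: strictly_coarser_def)
  ultimately show ?thesis using assms by blast
qed

function x_basis :: "nat \<Rightarrow> nat \<Rightarrow> diagram \<Rightarrow> diagram \<Rightarrow> 'a::field_char_0" where
  "x_basis n m \<pi> =
     (\<lambda>\<rho>. basis_vec \<pi> \<rho> - (\<Sum>\<mu>\<in>strictly_coarser n m \<pi>. x_basis n m \<mu> \<rho>))"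
  by pat_completeness auto
termination
proof (relation "measure (\<lambda>(n, m, \<pi>). card (strictly_coarser n m \<pi>))")
  fix n m \<pi> \<mu>
  assume "\<mu> \<in> strictly_coarser n m \<pi>"
  then show "((n, m, \<mu>), (n, m, \<pi>)) \<in> measure (\<lambda>(n, m, \<pi>). card (strictly_coarser n m \<pi>))"
    using psubset_card_mono[OF _ strictly_coarser_psubset] finite_P
    by (auto simp: strictly_coarser_def)
qed simp

declare x_basis.simps [simp del]


section \<open>Tensor powers of the permutation representation and the map $f$\<close>

definition index_functions :: "nat \<Rightarrow> nat \<Rightarrow> (nat \<Rightarrow> nat) set" where
  "index_functions n d = {1..n} \<rightarrow>\<^sub>E {1..d}"

(* The n-th tensor power of V_d, in coordinates with respect to its basis of the pure
   tensors v_i of basis vectors, indexed by i in [n,d]; the vector v_i is basis_vec i. *)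
definition tensor_power :: "nat \<Rightarrow> nat \<Rightarrow> ((nat \<Rightarrow> nat) \<Rightarrow> 'a::field_char_0) set" where
  "tensor_power n d = span_on (index_functions n d)"

fun color :: "(nat \<Rightarrow> nat) \<Rightarrow> (nat \<Rightarrow> nat) \<Rightarrow> vertex \<Rightarrow> nat" where
  "color i i' (Unprimed j) = i j"
| "color i i' (Primed j) = i' j"
| "color i i' (Doubly j) = undefined"

definition good_coloring :: "diagram \<Rightarrow> (nat \<Rightarrow> nat) \<Rightarrow> (nat \<Rightarrow> nat) \<Rightarrow> bool" where
  "good_coloring \<pi> i i' \<longleftrightarrow>
     (\<forall>B\<in>\<pi>. \<forall>x\<in>B. \<forall>y\<in>B. color i i' x = color i i' y)"

definition perfect_coloring :: "diagram \<Rightarrow> (nat \<Rightarrow> nat) \<Rightarrow> (nat \<Rightarrow> nat) \<Rightarrow> bool" where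
  "perfect_coloring \<pi> i i' \<longleftrightarrow>
     (\<forall>x\<in>\<Union>\<pi>. \<forall>y\<in>\<Union>\<pi>. color i i' x = color i i' y \<longleftrightarrow> (\<exists>B\<in>\<pi>. x \<in> B \<and> y \<in> B))"

definition f_map :: "nat \<Rightarrow> nat \<Rightarrow> nat \<Rightarrow> (diagram \<Rightarrow> 'a::field_char_0) \<Rightarrow>
    ((nat \<Rightarrow> nat) \<Rightarrow> 'a) \<Rightarrow> ((nat \<Rightarrow> nat) \<Rightarrow> 'a)" where
  "f_map n m d g w =
     (\<lambda>k. \<Sum>\<pi>\<in>P n m. \<Sum>i\<in>index_functions n d.
        g \<pi> * w i * (\<Sum>i' | i' \<in> index_functions m d \<and> good_coloring \<pi> i i'. basis_vec i' k))"


section \<open>Sums of cycles and their action\<close>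

(* A cycle is a permutation with exactly one nontrivial orbit, so the identity is not a
   1-cycle: there are no 1-cycles. For r \<ge> 2 this is the usual notion. Counting the
   identity as a 1-cycle would break the case r = 1: the formula for the coefficients of
   omega would give t for n = 0 and t - 1 for n = 1, while the identity acts by 1. *)
definition r_cycles :: "nat \<Rightarrow> nat \<Rightarrow> (nat \<Rightarrow> nat) set" where
  "r_cycles r d =
     {\<sigma>. \<sigma> permutes {1..d} \<and> cyclic_on \<sigma> {x. \<sigma> x \<noteq> x} \<and> card {x. \<sigma> x \<noteq> x} = r}"

(* Elements of the group algebra of S_d are coefficient functions on permutations. *)
definition Omega :: "nat \<Rightarrow> nat \<Rightarrow> (nat \<Rightarrow> nat) \<Rightarrow> 'a::field_char_0" where
  "Omega r d = (\<lambda>\<tau>. \<Sum>\<sigma>\<in>r_cycles r d. basis_vec \<sigma> \<tau>)"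

(* The linear extension of the diagonal action, which sends v_i to v_(\<sigma> \<circ> i). *)
definition action :: "nat \<Rightarrow> nat \<Rightarrow> ((nat \<Rightarrow> nat) \<Rightarrow> 'a::field_char_0) \<Rightarrow>
    ((nat \<Rightarrow> nat) \<Rightarrow> 'a) \<Rightarrow> ((nat \<Rightarrow> nat) \<Rightarrow> 'a)" where
  "action n d \<alpha> w =
     (\<lambda>k. \<Sum>\<sigma> | \<sigma> permutes {1..d}. \<Sum>i\<in>index_functions n d.
        \<alpha> \<sigma> * w i * basis_vec (compose {1..n} \<sigma> i) k)"

(* Uniquely determined, hence meaningful, for 0 < r \<le> d and 2 * n \<le> d. *)
definition C_elem :: "nat \<Rightarrow> nat \<Rightarrow> nat \<Rightarrow> diagram \<Rightarrow> 'a::field_char_0" where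
  "C_elem n r d =
     (THE g. g \<in> FP n n \<and>
        (\<forall>w\<in>tensor_power n d. f_map n n d g w = action n d (Omega r d) w))"


section \<open>The elements $\omega_n^r(t)$\<close>

definition num_parts :: "diagram \<Rightarrow> nat" where
  "num_parts \<pi> = card \<pi>"

definition num_fixed_parts :: "nat \<Rightarrow> diagram \<Rightarrow> nat" where
  "num_fixed_parts n \<pi> = card {B \<in> \<pi>. \<exists>j\<in>{1..n}. Unprimed j \<in> B \<and> Primed j \<in> B}"

definition num_joined_components :: "nat \<Rightarrow> diagram \<Rightarrow> nat" where
  "num_joined_components n \<pi> =
     card (components_of (\<pi> \<union> (\<lambda>j. {Unprimed j, Primed j}) ` {1..n}))"

definition perfect_pairs :: "nat \<Rightarrow> diagram \<Rightarrow> nat \<Rightarrow> ((nat \<Rightarrow> nat) \<times> (nat \<Rightarrow> nat)) set" where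
  "perfect_pairs n \<pi> d =
     {(i, i'). i \<in> index_functions n d \<and> i' \<in> index_functions n d \<and> perfect_coloring \<pi> i i'}"

definition S_defined :: "nat \<Rightarrow> diagram \<Rightarrow> nat \<Rightarrow> nat \<Rightarrow> bool" where
  "S_defined n \<pi> r d \<longleftrightarrow> 0 < r \<and> r \<le> d \<and> perfect_pairs n \<pi> d \<noteq> {}"

(* The count does not depend on the perfect coloring chosen. *)
definition S :: "nat \<Rightarrow> diagram \<Rightarrow> nat \<Rightarrow> nat \<Rightarrow> nat" where
  "S n \<pi> r d =
     (let (i, i') = (SOME p. p \<in> perfect_pairs n \<pi> d)
      in card {\<sigma> \<in> r_cycles r d. \<forall>j\<in>{1..n}. \<sigma> (i j) = i' j})"

(* In the second case a \<le> r + b and a < r + c, so the natural-number differences are not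
   truncated; r + c - a - 1 is the mathematical r - a + c - 1, and so on. *)
definition q_coeff :: "nat \<Rightarrow> diagram \<Rightarrow> nat \<Rightarrow> 'a::field_char_0 \<Rightarrow> 'a" where
  "q_coeff n \<pi> r t =
     (let a = num_parts \<pi>; b = num_fixed_parts n \<pi>; c = num_joined_components n \<pi> in
      if \<forall>d>1. S_defined n \<pi> r d \<longrightarrow> S n \<pi> r d = 0 then 0
      else fact (r + c - a - 1) / fact (r + b - a) *
           (\<Prod>k=1..r + b - a. t - of_nat r - of_nat b + of_nat k))"

definition omega :: "nat \<Rightarrow> nat \<Rightarrow> 'a::field_char_0 \<Rightarrow> diagram \<Rightarrow> 'a" where
  "omega n r t = (\<lambda>\<rho>. \<Sum>\<pi>\<in>P n n. q_coeff n \<pi> r t * x_basis n n \<pi> \<rho>)"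

end

theory Submission
  imports Defs "HOL-Computational_Algebra.Polynomial"
begin

text \<open>
  Over \<open>d\<close> colours a morphism \<open>g\<close> of \<open>FP n m\<close> is turned into the matrix whose \<open>(i, k)\<close> entry sums
  the coefficients of the diagrams for which \<open>(i, k)\<close> is a good colouring. For \<open>t = d\<close> this is
  functorial, and it is faithful as soon as \<open>d \<ge> n + m\<close>. The matrix of \<open>x\<^sub>\<pi>\<close> is the indicator of the
  perfect colourings of \<open>\<pi>\<close>, so the entries of \<open>\<omega>\<close> are the coefficients \<open>q\<close>, and part (1) says that
  \<open>q\<close> counts the \<open>r\<close>-cycles that send \<open>i\<^sub>j\<close> to \<open>k\<^sub>j\<close> for all \<open>j\<close>.

  The prescriptions \<open>i\<^sub>j \<mapsto> k\<^sub>j\<close> form a graph on the colours. Its loops are fixed points; the support of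
  the cycle consists of the \<open>a - b\<close> remaining colours and of \<open>r - a + b\<close> arbitrary unused ones. On a
  given support, contracting the prescribed edges one by one leaves the free cyclic permutations of
  the \<open>r - a + c\<close> connected components, of which there are \<open>(r - a + c - 1)!\<close>.

  For part (2), the matrices of diagrams commute with the symmetric group, so naturality holds for
  all large integers \<open>t = d\<close>; both sides are polynomial in \<open>t\<close>, hence it holds for every \<open>t\<close>.
\<close>

section \<open>Cyclic permutations with prescribed values\<close>

text \<open>The numbers \<open>a\<close>, \<open>b\<close>, \<open>c\<close> do not reveal whether
  any cycle exists, since a prescription may fail to be injective or may close up a cycle too early.
  The definition of \<open>q\<close> tests this by \<open>S\<close>, for some \<open>d\<close> and
  for an arbitrarily chosen perfect colouring. The obstacle is to pass from that single witness to
  the given colouring, the given \<open>d\<close> and every possible support; conjugation by a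
  bijection of supports does it. The bound \<open>d \<ge> 2 * n + r\<close> has two sources: at most
  \<open>2 * n\<close> colours are prescribed, so \<open>r\<close> further ones are free to complete
  a support, and \<open>n + n \<le> d\<close> makes the matrix determine the morphism.
  Characteristic zero enters through the factorials and through the infinitely many integers at
  which naturality is checked. There are no 1-cycles, so for \<open>r = 1\<close> both sides of part
  (1) are zero.\<close>

definition cyclic_perms :: "'a set \<Rightarrow> ('a \<Rightarrow> 'a) set" where
  "cyclic_perms X = {\<sigma>. \<sigma> permutes X \<and> cyclic_on \<sigma> X}"

definition respects_edges :: "('a \<times> 'a) set \<Rightarrow> ('a \<Rightarrow> 'a) \<Rightarrow> bool" where
  "respects_edges E \<sigma> \<longleftrightarrow> (\<forall>e\<in>E. \<sigma> (fst e) = snd e)"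

text \<open>A graph with \<open>c\<close> connected components has \<open>2 ^ c\<close> subsets closed under adjacency; counting these
  replaces any manipulation of the components themselves.\<close>

definition closed_subsets :: "'a set \<Rightarrow> ('a \<times> 'a) set \<Rightarrow> 'a set set" where
  "closed_subsets X E = {A. A \<subseteq> X \<and> (\<forall>e\<in>E. fst e \<in> A \<longleftrightarrow> snd e \<in> A)}"

text \<open>The orbit of a point of \<open>A\<close> stays in \<open>A\<close>, and it is all of
  \<open>X\<close>. With the converse below, cyclicity becomes the absence of proper invariant
  subsets, a property that can be followed through a composition with a transposition without
  computing orbits.\<close>

lemma cyclic_on_invariant_subset_eq:
  assumes "cyclic_on \<sigma> X" "A \<subseteq> X" "A \<noteq> {}" "\<sigma> ` A \<subseteq> A"
  shows "A = X"
proof -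
  obtain a where a: "a \<in> A" using assms(3) by blast
  then have "X = orbit \<sigma> a"
    using assms(1,2) unfolding cyclic_on_alldef by blast
  moreover have "x \<in> A" if "x \<in> orbit \<sigma> a" for x
    using that by induction (use a assms(4) in auto)
  ultimately show ?thesis using assms(2) by blast
qed

lemma cyclic_on_if_no_invariant_subset:
  assumes "\<sigma> permutes X" "a \<in> X"
    and "\<And>A. A \<subseteq> X \<Longrightarrow> A \<noteq> {} \<Longrightarrow> \<sigma> ` A \<subseteq> A \<Longrightarrow> A = X"
  shows "cyclic_on \<sigma> X"
proof -
  have "orbit \<sigma> a = X"
    using permutes_orbit_subset[OF assms(1,2)] orbit_nonempty
    by (rule assms(3)) (auto intro: orbit.intros)
  then show ?thesis using assms(2) unfolding cyclic_on_def by blast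
qed

lemma finite_cyclic_perms: "finite X \<Longrightarrow> finite (cyclic_perms X)"
  by (rule finite_subset[OF _ finite_permutations[of X]]) (auto simp: cyclic_perms_def)

text \<open>The composite fixes \<open>y\<close> and sends \<open>x\<close> to
  \<open>\<sigma> y\<close>: it takes \<open>y\<close> out of the cycle and lets \<open>x\<close>
  inherit its outgoing arrow.\<close>

lemma cyclic_perms_contract:
  assumes "x \<in> X" "y \<in> X" "x \<noteq> y" and \<sigma>: "\<sigma> \<in> cyclic_perms X" "\<sigma> x = y"
  shows "\<sigma> \<circ> transpose x y \<in> cyclic_perms (X - {y})"
proof -
  let ?\<tau> = "\<sigma> \<circ> transpose x y"
  have p: "\<sigma> permutes X" and cyc: "cyclic_on \<sigma> X"
    using \<sigma>(1) by (auto simp: cyclic_perms_def)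
  have "transpose x y permutes X" using assms by (simp add: permutes_swap_id)
  then have "?\<tau> permutes X" using p by (rule permutes_compose)
  moreover have "?\<tau> y = y" using \<sigma> by simp
  ultimately have p': "?\<tau> permutes X - {y}"
    by (intro permutes_superset[where S = X and T = "X - {y}"]) (simp_all only: Diff_iff singleton_iff not_not, blast)
  \<comment> \<open>An invariant set of the contracted permutation becomes an invariant set of
    \<open>\<sigma>\<close> once \<open>y\<close> is put back in case it contains
    \<open>x\<close>.\<close>
  have "A = X - {y}" if A: "A \<subseteq> X - {y}" "A \<noteq> {}" "?\<tau> ` A \<subseteq> A" for A
  proof (cases "x \<in> A")
    case True
    have "\<sigma> ` insert y A \<subseteq> insert y A"
    proof clarify
      fix z assume z: "z \<in> insert y A" "\<sigma> z \<notin> A"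
      show "\<sigma> z = y"
      proof (cases "z = x \<or> z = y")
        case True
        then show ?thesis using \<sigma> z A(3) \<open>x \<in> A\<close> by auto
      next
        case False
        then have "?\<tau> z = \<sigma> z" by simp
        then show ?thesis using z A(3) False by auto
      qed
    qed
    then have "insert y A = X"
      using A(1) assms(2) by (intro cyclic_on_invariant_subset_eq[OF cyc]) auto
    then show ?thesis using A(1) by blast
  next
    case False
    have "?\<tau> z = \<sigma> z" if "z \<in> A" for z using that False A(1) by (auto simp: transpose_def)
    then have "\<sigma> ` A \<subseteq> A" using A(3) by auto
    then have "A = X"
      using A(1,2) by (intro cyclic_on_invariant_subset_eq[OF cyc]) auto
    then show ?thesis using False assms(1) by blast
  qed
  then have "cyclic_on ?\<tau> (X - {y})"
    using assms(1,3) by (intro cyclic_on_if_no_invariant_subset[OF p', of x]) blast+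
  then show ?thesis using p' by (simp add: cyclic_perms_def)
qed

text \<open>The inverse construction: \<open>y\<close> is inserted into the cycle right after
  \<open>x\<close>.\<close>

lemma cyclic_perms_expand:
  assumes "x \<in> X" "y \<in> X" "x \<noteq> y" and \<tau>: "\<tau> \<in> cyclic_perms (X - {y})"
  shows "\<tau> \<circ> transpose x y \<in> cyclic_perms X" "(\<tau> \<circ> transpose x y) x = y"
proof -
  let ?\<sigma> = "\<tau> \<circ> transpose x y"
  have p': "\<tau> permutes X - {y}" and cyc: "cyclic_on \<tau> (X - {y})"
    using \<tau> by (auto simp: cyclic_perms_def)
  have \<tau>y: "\<tau> y = y" using p' by (simp add: permutes_def)
  then show \<sigma>x: "?\<sigma> x = y" by simp
  have "\<tau> permutes X" using p' by (rule permutes_subset) auto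
  moreover have "transpose x y permutes X" using assms by (simp add: permutes_swap_id)
  ultimately have p: "?\<sigma> permutes X" using permutes_compose by blast
  have inj: "\<tau> u = \<tau> v \<longleftrightarrow> u = v" for u v using permutes_inj[OF p'] by (auto simp: inj_def)
  have "A = X" if A: "A \<subseteq> X" "A \<noteq> {}" "?\<sigma> ` A \<subseteq> A" for A
  proof -
    have mem: "?\<sigma> z \<in> A" if "z \<in> A" for z using A(3) that by blast
    have y: "\<tau> x \<in> A" if "y \<in> A" using mem[OF that] by simp
    \<comment> \<open>At \<open>z = x\<close> the permutation \<open>?\<sigma>\<close> takes two
      steps, from \<open>x\<close> to \<open>y\<close> and from \<open>y\<close> to
      \<open>\<tau> x\<close>, where \<open>\<tau>\<close> takes one. The value \<open>y\<close> is
      excluded because \<open>\<tau>\<close> is injective and fixes \<open>y\<close>.\<close>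
    have "\<tau> z \<in> A - {y}" if "z \<in> A - {y}" for z
    proof (cases "z = x")
      case True
      then show ?thesis using mem[of x] \<sigma>x y that inj[of x y] \<tau>y assms(3) by auto
    next
      case False
      then show ?thesis using mem[of z] that inj[of z y] \<tau>y by (auto simp: transpose_def)
    qed
    moreover have "A - {y} \<noteq> {}"
    proof
      assume "A - {y} = {}"
      then have "A = {y}" using A(2) by blast
      then show False using y inj[of x y] \<tau>y assms(3) by auto
    qed
    ultimately have "\<tau> ` (A - {y}) \<subseteq> A - {y}" "A - {y} \<noteq> {}" by blast+
    moreover have "A - {y} \<subseteq> X - {y}" using A(1) by blast
    ultimately have *: "A - {y} = X - {y}"
      by (intro cyclic_on_invariant_subset_eq[OF cyc])
    then have "x \<in> A" using assms(1,3) by blast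
    then have "y \<in> A" using mem[of x] \<sigma>x by simp
    then show ?thesis using * A(1) by blast
  qed
  then have "cyclic_on ?\<sigma> X"
    by (intro cyclic_on_if_no_invariant_subset[OF p assms(1)]) blast
  then show "?\<sigma> \<in> cyclic_perms X" using p by (simp add: cyclic_perms_def)
qed

lemma bij_betw_cyclic_perms_contract:
  assumes "x \<in> X" "y \<in> X" "x \<noteq> y"
  shows "bij_betw (\<lambda>\<sigma>. \<sigma> \<circ> transpose x y) {\<sigma> \<in> cyclic_perms X. \<sigma> x = y} (cyclic_perms (X - {y}))"
proof (rule bij_betw_byWitness[where f' = "\<lambda>\<tau>. \<tau> \<circ> transpose x y"])
  show "(\<lambda>\<tau>. \<tau> \<circ> transpose x y) ` cyclic_perms (X - {y}) \<subseteq> {\<sigma> \<in> cyclic_perms X. \<sigma> x = y}"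
    using cyclic_perms_expand[OF assms] by blast
qed (use assms in \<open>auto intro: cyclic_perms_contract simp: comp_assoc\<close>)

text \<open>Sort the cycles by the image \<open>y\<close> of a fixed point \<open>x\<close>. On
  \<open>k + 1\<close> points with \<open>k > 0\<close> there are \<open>k\<close> choices of
  \<open>y\<close>, and contraction leaves the cycles on \<open>k\<close> points.\<close>

lemma card_cyclic_perms:
  assumes "finite X" "X \<noteq> {}"
  shows "card (cyclic_perms X) = fact (card X - 1)"
  using assms
proof (induction "card X" arbitrary: X)
  case 0
  then show ?case by simp
next
  case (Suc k)
  show ?case
  proof (cases "k = 0")
    case True
    then obtain x where X: "X = {x}" using Suc by (metis card_1_singletonE One_nat_def)
    have "cyclic_perms X = {id}"
      unfolding X by (auto simp: cyclic_perms_def cyclic_on_def orbit_eq_singleton_iff[THEN iffD2])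
    then show ?thesis using Suc(2) True by simp
  next
    case False
    obtain x where x: "x \<in> X" using Suc by blast
    have ne: "\<sigma> x \<in> X - {x}" if "\<sigma> \<in> cyclic_perms X" for \<sigma>
    proof -
      have "\<sigma> x \<noteq> x" using that x Suc(2) False
        by (metis (mono_tags, lifting) One_nat_def cyclic_perms_def eq_on_cyclic_on_iff1 mem_Collect_eq nat.inject)
      moreover have "\<sigma> x \<in> X" using that x by (auto simp: cyclic_perms_def permutes_in_image)
      ultimately show ?thesis by simp
    qed
    have "cyclic_perms X = (\<Union>y\<in>X - {x}. {\<sigma> \<in> cyclic_perms X. \<sigma> x = y})"
      using ne by blast
    also have "card \<dots> = (\<Sum>y\<in>X - {x}. card {\<sigma> \<in> cyclic_perms X. \<sigma> x = y})"
      using Suc(3) by (intro card_UN_disjoint) (auto intro: rev_finite_subset[OF finite_cyclic_perms])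
    also have "\<dots> = (\<Sum>y\<in>X - {x}. fact (k - 1))"
    proof (rule sum.cong[OF refl])
      fix y assume y: "y \<in> X - {x}"
      have c: "k = card (X - {y})" using y Suc(2,3) by simp
      have "card {\<sigma> \<in> cyclic_perms X. \<sigma> x = y} = card (cyclic_perms (X - {y}))"
        using y by (intro bij_betw_same_card[OF bij_betw_cyclic_perms_contract] x) auto
      also have "\<dots> = fact (k - 1)"
        unfolding c using Suc(3) c False by (intro Suc(1)[OF c]) auto
      finally show "card {\<sigma> \<in> cyclic_perms X. \<sigma> x = y} = fact (k - 1)" .
    qed
    also have "\<dots> = k * fact (k - 1)" using x Suc(2,3) by simp
    also have "\<dots> = fact (card X - 1)" using False Suc(2)[symmetric] by (simp add: fact_reduce)
    finally show ?thesis .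
  qed
qed

section \<open>Contracting the prescribed edges\<close>

lemma closed_subsets_iff:
  "A \<in> closed_subsets X E \<longleftrightarrow> A \<subseteq> X \<and> (\<forall>u v. (u, v) \<in> E \<longrightarrow> u \<in> A \<longleftrightarrow> v \<in> A)"
  by (simp add: closed_subsets_def Ball_def split_paired_All)

lemma closed_subsets_map_iff:
  "A \<in> closed_subsets X (map_prod h id ` E) \<longleftrightarrow>
    A \<subseteq> X \<and> (\<forall>u v. (u, v) \<in> E \<longrightarrow> (h u \<in> A \<longleftrightarrow> v \<in> A))"
proof -
  have "(\<forall>e\<in>map_prod h id ` E. fst e \<in> A \<longleftrightarrow> snd e \<in> A) \<longleftrightarrow> (\<forall>e\<in>E. h (fst e) \<in> A \<longleftrightarrow> snd e \<in> A)" by simp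
  also have "\<dots> \<longleftrightarrow> (\<forall>u v. (u, v) \<in> E \<longrightarrow> (h u \<in> A \<longleftrightarrow> v \<in> A))" 
    by (simp only: Ball_def split_paired_All fst_conv snd_conv)
  finally show ?thesis by (simp only: closed_subsets_def mem_Collect_eq)
qed

text \<open>Edges out of \<open>y\<close> now start at \<open>x\<close>, which is why the
  transposition acts on first components only. By \<open>out\<close> and \<open>into\<close>, no
  other edge starts at \<open>x\<close> or ends at \<open>y\<close>, so nothing else changes. A
  closed set contains both \<open>x\<close> and \<open>y\<close> or neither, hence deleting
  \<open>y\<close> loses no information: contraction preserves the number of components.\<close>

lemma card_closed_subsets_contract:
  assumes "(x, y) \<in> E" "E \<subseteq> X \<times> X" "x \<noteq> y"
    and out: "\<And>v. (x, v) \<in> E \<Longrightarrow> v = y" and into: "\<And>u. (u, y) \<in> E \<Longrightarrow> u = x"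
  shows "card (closed_subsets X E) =
    card (closed_subsets (X - {y}) (map_prod (transpose x y) id ` (E - {(x, y)})))"
proof (rule bij_betw_same_card)
  let ?E' = "map_prod (transpose x y) id ` (E - {(x, y)})"
  have xy: "x \<in> X" "y \<in> X" using assms(1,2) by blast+
  have edge: "u \<noteq> x" "v \<noteq> y" if "(u, v) \<in> E - {(x, y)}" for u v
    using that out into by blast+
  have tr: "transpose x y u \<in> A - {y} \<longleftrightarrow> u \<in> A" if "x \<in> A \<longleftrightarrow> y \<in> A" "u \<noteq> x" for u A
    using that assms(3) by (cases "u = y") auto
  show "bij_betw (\<lambda>A. A - {y}) (closed_subsets X E) (closed_subsets (X - {y}) ?E')"
  proof (rule bij_betw_byWitness[where f' = "\<lambda>A. if x \<in> A then insert y A else A"])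
    show "\<forall>A\<in>closed_subsets X E. (if x \<in> A - {y} then insert y (A - {y}) else A - {y}) = A"
      using assms(1,3) by (auto simp: closed_subsets_def)
    show "\<forall>A\<in>closed_subsets (X - {y}) ?E'. (if x \<in> A then insert y A else A) - {y} = A"
      by (auto simp: closed_subsets_def)
    show "(\<lambda>A. A - {y}) ` closed_subsets X E \<subseteq> closed_subsets (X - {y}) ?E'"
    proof clarify
      fix A assume "A \<in> closed_subsets X E"
      then have A: "A \<subseteq> X" "\<And>u v. (u, v) \<in> E \<Longrightarrow> u \<in> A \<longleftrightarrow> v \<in> A"
        unfolding closed_subsets_iff by blast+
      have "transpose x y u \<in> A - {y} \<longleftrightarrow> v \<in> A - {y}" if "(u, v) \<in> E - {(x, y)}" for u v
        using tr[of A u] A(2)[of x y] A(2)[of u v] edge[OF that] that assms(1) by blast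
      then show "A - {y} \<in> closed_subsets (X - {y}) ?E'"
        using A(1) unfolding closed_subsets_map_iff by blast
    qed
    show "(\<lambda>A. if x \<in> A then insert y A else A) ` closed_subsets (X - {y}) ?E' \<subseteq> closed_subsets X E"
    proof clarify
      fix A assume "A \<in> closed_subsets (X - {y}) ?E'"
      then have A: "A \<subseteq> X - {y}" "\<And>u v. (u, v) \<in> E - {(x, y)} \<Longrightarrow> transpose x y u \<in> A \<longleftrightarrow> v \<in> A"
        unfolding closed_subsets_map_iff by blast+
      let ?A = "if x \<in> A then insert y A else A"
      have A': "?A - {y} = A" "x \<in> ?A \<longleftrightarrow> y \<in> ?A" using A(1) by auto
      have "u \<in> ?A \<longleftrightarrow> v \<in> ?A" if "(u, v) \<in> E" for u v
      proof (cases "(u, v) = (x, y)")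
        case True
        then show ?thesis using A'(2) by blast
      next
        case False
        then have *: "(u, v) \<in> E - {(x, y)}" using that by blast
        have "u \<in> ?A \<longleftrightarrow> transpose x y u \<in> A"
          using tr[OF A'(2) edge(1)[OF *]] unfolding A'(1) by blast
        also have "\<dots> \<longleftrightarrow> v \<in> ?A" using A(2)[OF *] edge(2)[OF *] A'(1) by blast
        finally show ?thesis .
      qed
      moreover have "?A \<subseteq> X" using A(1) xy by auto
      ultimately show "?A \<in> closed_subsets X E" unfolding closed_subsets_iff by blast
    qed
  qed
qed

text \<open>Each contraction keeps \<open>c\<close>, so the induction on the size of
  \<open>X\<close> ends with a graph without proper edges. The witness \<open>\<sigma>0\<close> is
  contracted along with the graph: its injectivity gives each edge the uniqueness that contraction
  requires, and its cyclicity excludes prescribed cycles that close up before covering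
  \<open>X\<close>.\<close>

lemma card_cyclic_perms_respecting:
  assumes "finite X" "E \<subseteq> X \<times> X" "\<sigma>0 \<in> cyclic_perms X" "respects_edges E \<sigma>0"
    and "card (closed_subsets X E) = 2 ^ c"
  shows "card {\<sigma> \<in> cyclic_perms X. respects_edges E \<sigma>} = fact (c - 1)"
  using assms
proof (induction "card X" arbitrary: X E \<sigma>0)
  case 0
  then show ?case by (auto simp: cyclic_perms_def cyclic_on_def)
next
  case (Suc k)
  have ne: "X \<noteq> {}" using Suc(2) by auto
  have \<sigma>0: "\<sigma>0 permutes X" "cyclic_on \<sigma>0 X" using Suc.prems(3) by (auto simp: cyclic_perms_def)
  have E\<sigma>0: "\<sigma>0 u = v" if "(u, v) \<in> E" for u v
    using Suc.prems(4) that by (auto simp: respects_edges_def)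
  show ?case
  proof (cases "\<exists>(x, y)\<in>E. x \<noteq> y")
    case True
    then obtain x y where xy: "(x, y) \<in> E" "x \<noteq> y" by blast
    let ?E' = "map_prod (transpose x y) id ` (E - {(x, y)})"
    have mem: "x \<in> X" "y \<in> X" using xy Suc.prems(2) by auto
    have out: "v = y" if "(x, v) \<in> E" for v using E\<sigma>0[OF that] E\<sigma>0[OF xy(1)] by simp
    have into: "u = x" if "(u, y) \<in> E" for u
      using E\<sigma>0[OF that] E\<sigma>0[OF xy(1)] permutes_inj[OF \<sigma>0(1)] by (metis injD)
    \<comment> \<open>The sources in \<open>?E'\<close> carry the transposition, which cancels
      against the one in \<open>\<sigma> \<circ> transpose x y\<close>.\<close>
    have resp: "respects_edges E \<sigma> \<longleftrightarrow> \<sigma> x = y \<and> respects_edges ?E' (\<sigma> \<circ> transpose x y)" for \<sigma>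
    proof -
      have "respects_edges ?E' (\<sigma> \<circ> transpose x y) \<longleftrightarrow> respects_edges (E - {(x, y)}) \<sigma>"
        by (simp add: respects_edges_def case_prod_beta)
      moreover have "respects_edges E \<sigma> \<longleftrightarrow> \<sigma> x = y \<and> respects_edges (E - {(x, y)}) \<sigma>"
        using xy(1) unfolding respects_edges_def by (metis Diff_iff fst_conv singletonD snd_conv)
      ultimately show ?thesis by blast
    qed
    note bij = bij_betw_cyclic_perms_contract[OF mem xy(2)]
    have "card {\<sigma> \<in> cyclic_perms X. respects_edges E \<sigma>} =
        card {\<sigma> \<in> {\<sigma> \<in> cyclic_perms X. \<sigma> x = y}. respects_edges ?E' (\<sigma> \<circ> transpose x y)}"
      by (rule arg_cong[of _ _ card]) (use resp in blast)
    also have "\<dots> = card {\<tau> \<in> cyclic_perms (X - {y}). respects_edges ?E' \<tau>}"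
      by (rule bij_betw_same_card, rule bij_betw_Collect[OF bij]) simp
    also have "\<dots> = fact (c - 1)"
    proof (rule Suc.hyps(1))
      show "k = card (X - {y})" using Suc.hyps(2) Suc.prems(1) mem by simp
      show "finite (X - {y})" using Suc.prems(1) by simp
      show "?E' \<subseteq> (X - {y}) \<times> (X - {y})"
      proof
        fix e assume "e \<in> ?E'"
        then obtain u v where uv: "(u, v) \<in> E - {(x, y)}" "e = (transpose x y u, v)"
          by (elim imageE) (metis id_apply map_prod_simp surj_pair)
        then have "u \<noteq> x" "v \<noteq> y" "u \<in> X" "v \<in> X" using out into Suc.prems(2) by blast+
        then show "e \<in> (X - {y}) \<times> (X - {y})"
          using uv(2) mem xy(2) by (auto simp: transpose_def)
      qed
      show "\<sigma>0 \<circ> transpose x y \<in> cyclic_perms (X - {y})"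
        using cyclic_perms_contract[OF mem xy(2) Suc.prems(3) E\<sigma>0[OF xy(1)]] .
      show "respects_edges ?E' (\<sigma>0 \<circ> transpose x y)" using resp Suc.prems(4) by blast
      show "card (closed_subsets (X - {y}) ?E') = 2 ^ c"
        using card_closed_subsets_contract[OF xy(1) Suc.prems(2) xy(2) out into] Suc.prems(5) by simp
    qed
    finally show ?thesis .
  next
    case False
    \<comment> \<open>Only loops are left, and a loop gives a cyclic permutation a fixed point,
      which is possible on one point only. So the edges impose no condition, and \<open>c\<close> is
      the size of \<open>X\<close>.\<close>
    have single: "card X = 1" if "(x, x) \<in> E" for x
      using eq_on_cyclic_on_iff1[OF \<sigma>0(2), of x] E\<sigma>0[OF that] that Suc.prems(2) by blast
    have all: "respects_edges E \<sigma>" if "\<sigma> \<in> cyclic_perms X" for \<sigma>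
    proof -
      have "\<sigma> u = v" if uv: "(u, v) \<in> E" for u v
      proof -
        have "u = v" using False uv by blast
        then have "card X = 1" using single uv by blast
        moreover have "u \<in> X" "\<sigma> u \<in> X"
          using uv Suc.prems(2) \<open>\<sigma> \<in> cyclic_perms X\<close> by (auto simp: cyclic_perms_def permutes_in_image)
        ultimately show ?thesis using \<open>u = v\<close> by (metis card_1_singletonE singletonD)
      qed
      then show ?thesis by (auto simp: respects_edges_def)
    qed
    have "closed_subsets X E = Pow X" using False by (auto simp: closed_subsets_def)
    then have "c = card X" using Suc.prems(1,5) by (simp add: card_Pow)
    moreover have "{\<sigma> \<in> cyclic_perms X. respects_edges E \<sigma>} = cyclic_perms X" using all by blast
    ultimately show ?thesis using card_cyclic_perms[OF Suc.prems(1) ne] by simp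
  qed
qed

section \<open>Matrices of diagrams\<close>

definition kernel :: "nat \<Rightarrow> nat \<Rightarrow> (nat \<Rightarrow> nat) \<Rightarrow> (nat \<Rightarrow> nat) \<Rightarrow> diagram" where
  "kernel n m i k = (\<lambda>c. {v \<in> vertices n m. color i k v = c}) ` color i k ` vertices n m"

text \<open>The number of colours does not enter the entries; it only bounds the range of
  \<open>i\<close> and \<open>k\<close>.\<close>

definition matrix_coeff ::
    "nat \<Rightarrow> nat \<Rightarrow> (diagram \<Rightarrow> 'a::field_char_0) \<Rightarrow> (nat \<Rightarrow> nat) \<Rightarrow> (nat \<Rightarrow> nat) \<Rightarrow> 'a" where
  "matrix_coeff n m g i k = (\<Sum>\<pi>\<in>P n m. if good_coloring \<pi> i k then g \<pi> else 0)"

lemma finite_vertices: "finite (vertices n m)"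
  by (simp add: vertices_def)

lemma kernel_in_P: "kernel n m i k \<in> P n m"
  unfolding P_def kernel_def mem_Collect_eq
  by (rule partition_onI) (auto simp: disjnt_def)

lemma in_same_kernel_part:
  "(\<exists>B\<in>kernel n m i k. x \<in> B \<and> y \<in> B) \<longleftrightarrow>
    x \<in> vertices n m \<and> y \<in> vertices n m \<and> color i k x = color i k y"
  unfolding kernel_def by auto

lemma good_coloring_iff_refines:
  assumes "\<pi> \<in> P n m"
  shows "good_coloring \<pi> i k \<longleftrightarrow> refines (vertices n m) \<pi> (kernel n m i k)"
proof
  have \<pi>: "partition_on (vertices n m) \<pi>" using assms by (simp add: P_def)
  assume good: "good_coloring \<pi> i k"
  have "\<exists>C\<in>kernel n m i k. B \<subseteq> C" if B: "B \<in> \<pi>" for B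
  proof -
    have "B \<noteq> {}" "B \<subseteq> vertices n m" using \<pi> B by (auto simp: partition_on_def)
    then obtain v where v: "v \<in> B" "v \<in> vertices n m" by blast
    have "B \<subseteq> {w \<in> vertices n m. color i k w = color i k v}"
      using good B v \<open>B \<subseteq> vertices n m\<close> unfolding good_coloring_def by blast
    then show ?thesis using v(2) unfolding kernel_def by blast
  qed
  then show "refines (vertices n m) \<pi> (kernel n m i k)"
    using \<pi> kernel_in_P[of n m i k] unfolding refines_def P_def by blast
next
  assume "refines (vertices n m) \<pi> (kernel n m i k)"
  then have sub: "\<exists>C\<in>kernel n m i k. B \<subseteq> C" if "B \<in> \<pi>" for B
    using that unfolding refines_def by blast
  show "good_coloring \<pi> i k"
    unfolding good_coloring_def
  proof (intro ballI)
    fix B x y assume B: "B \<in> \<pi>" "x \<in> B" "y \<in> B"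
    obtain C where "C \<in> kernel n m i k" "B \<subseteq> C" using sub[OF B(1)] by (elim bexE)
    then have "\<exists>C\<in>kernel n m i k. x \<in> C \<and> y \<in> C" using B(2,3) by auto
    then show "color i k x = color i k y" unfolding in_same_kernel_part by blast
  qed
qed

lemma perfect_coloring_iff_kernel:
  assumes "\<pi> \<in> P n m"
  shows "perfect_coloring \<pi> i k \<longleftrightarrow> \<pi> = kernel n m i k"
proof -
  have part: "partition_on (vertices n m) \<pi>" "partition_on (vertices n m) (kernel n m i k)"
    using assms kernel_in_P[of n m i k] by (auto simp: P_def)
  have un: "\<Union>\<pi> = vertices n m" using part(1) by (auto simp: partition_on_def)
  show ?thesis
  proof
    assume perf: "perfect_coloring \<pi> i k"
    have "{(x, y). \<exists>B\<in>\<pi>. x \<in> B \<and> y \<in> B} = {(x, y). \<exists>B\<in>kernel n m i k. x \<in> B \<and> y \<in> B}"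
    proof (intro Collect_cong, clarify)
      fix x y
      show "(\<exists>B\<in>\<pi>. x \<in> B \<and> y \<in> B) \<longleftrightarrow> (\<exists>B\<in>kernel n m i k. x \<in> B \<and> y \<in> B)"
      proof (cases "x \<in> vertices n m \<and> y \<in> vertices n m")
        case True
        then have "color i k x = color i k y \<longleftrightarrow> (\<exists>B\<in>\<pi>. x \<in> B \<and> y \<in> B)"
          using perf unfolding perfect_coloring_def un by blast
        then show ?thesis using True unfolding in_same_kernel_part by simp
      next
        case False
        moreover have "x \<in> vertices n m \<and> y \<in> vertices n m" if "\<exists>B\<in>\<pi>. x \<in> B \<and> y \<in> B"
          unfolding un[symmetric] using that by auto
        ultimately show ?thesis unfolding in_same_kernel_part by auto
      qed
    qed
    \<comment> \<open>A partition is recovered as the quotient by the relation of lying in a common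
      part.\<close>
    from arg_cong[OF this, of "(//) (vertices n m)"] show "\<pi> = kernel n m i k"
      unfolding partition_on_eq_quotient[OF part(1)] partition_on_eq_quotient[OF part(2)] .
  next
    assume "\<pi> = kernel n m i k"
    then show "perfect_coloring \<pi> i k"
      unfolding perfect_coloring_def un by (simp add: in_same_kernel_part)
  qed
qed

lemma good_coloring_iff_coarser:
  assumes "\<pi> \<in> P n m"
  shows "good_coloring \<pi> i k \<longleftrightarrow>
    \<pi> = kernel n m i k \<or> kernel n m i k \<in> strictly_coarser n m \<pi>"
  using good_coloring_iff_refines[OF assms, of i k] kernel_in_P[of n m i k] assms
  unfolding strictly_coarser_def P_def by (auto intro: refines_refl)

lemma span_on_sum:
  assumes "\<And>x. x \<in> A \<Longrightarrow> g x \<in> span_on X"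
  shows "(\<lambda>\<rho>. \<Sum>x\<in>A. c x * g x \<rho>) \<in> span_on X"
  using assms by (auto simp: span_on_def intro!: sum.neutral)

lemma x_basis_in_FP: "\<pi> \<in> P n m \<Longrightarrow> x_basis n m \<pi> \<in> FP n m"
proof (induction n m \<pi> rule: x_basis.induct)
  case (1 n m \<pi>)
  then have "x_basis n m \<mu> \<rho> = (0::'a)" if "\<mu> \<in> strictly_coarser n m \<pi>" "\<rho> \<notin> P n m" for \<mu> \<rho>
    using that by (auto simp: FP_def span_on_def strictly_coarser_def)
  then show ?case using 1(2)
    by (auto simp: FP_def span_on_def x_basis.simps[of n m \<pi>] basis_vec_def)
qed

lemma omega_in_FP: "omega n r t \<in> FP n n"
  unfolding omega_def FP_def by (intro span_on_sum) (metis FP_def x_basis_in_FP)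

lemma matrix_coeff_sum:
  "matrix_coeff n m (\<lambda>\<rho>. \<Sum>x\<in>A. c x * g x \<rho>) i k = (\<Sum>x\<in>A. c x * matrix_coeff n m (g x) i k)"
  unfolding matrix_coeff_def sum_distrib_left
  by (subst sum.swap) (auto intro!: sum.cong)

lemma matrix_coeff_basis_vec:
  assumes "\<pi> \<in> P n m"
  shows "matrix_coeff n m (basis_vec \<pi>) i k = of_bool (good_coloring \<pi> i k)"
proof -
  have "matrix_coeff n m (basis_vec \<pi>) i k =
      (\<Sum>\<rho>\<in>P n m. if \<rho> = \<pi> then of_bool (good_coloring \<pi> i k) else 0 :: 'a)"
    unfolding matrix_coeff_def basis_vec_def by (rule sum.cong) auto
  then show ?thesis using assms finite_P by (simp add: sum.delta)
qed

text \<open>A colouring is good for \<open>\<pi>\<close> exactly when it is perfect for some diagram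
  equal to or coarser than \<open>\<pi>\<close>, namely its kernel. The recursion for
  \<open>x_basis\<close> is the Moebius inversion of this relation.\<close>

lemma matrix_coeff_x_basis:
  "\<pi> \<in> P n m \<Longrightarrow> matrix_coeff n m (x_basis n m \<pi>) i k = of_bool (\<pi> = kernel n m i k)"
proof (induction n m \<pi> rule: x_basis.induct)
  case (1 n m \<pi>)
  let ?K = "kernel n m i k"
  have fin: "finite (strictly_coarser n m \<pi>)"
    using finite_P by (auto simp: strictly_coarser_def)
  have "matrix_coeff n m (x_basis n m \<pi>) i k =
      (\<Sum>\<rho>\<in>P n m. (if good_coloring \<rho> i k then basis_vec \<pi> \<rho> else 0) -
        (if good_coloring \<rho> i k then \<Sum>\<mu>\<in>strictly_coarser n m \<pi>. 1 * x_basis n m \<mu> \<rho> else 0))"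
    unfolding matrix_coeff_def by (subst x_basis.simps) (auto intro!: sum.cong)
  also have "\<dots> = matrix_coeff n m (basis_vec \<pi>) i k -
      matrix_coeff n m (\<lambda>\<rho>. \<Sum>\<mu>\<in>strictly_coarser n m \<pi>. 1 * x_basis n m \<mu> \<rho>) i k"
    unfolding matrix_coeff_def sum_subtractf ..
  also have "\<dots> = of_bool (good_coloring \<pi> i k) -
      (\<Sum>\<mu>\<in>strictly_coarser n m \<pi>. matrix_coeff n m (x_basis n m \<mu>) i k)"
    unfolding matrix_coeff_sum matrix_coeff_basis_vec[OF 1(2)] by simp
  also have "(\<Sum>\<mu>\<in>strictly_coarser n m \<pi>. matrix_coeff n m (x_basis n m \<mu>) i k) =
      (\<Sum>\<mu>\<in>strictly_coarser n m \<pi>. if \<mu> = ?K then 1 else 0 :: 'a)"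
  proof (rule sum.cong[OF refl])
    fix \<mu> assume "\<mu> \<in> strictly_coarser n m \<pi>"
    moreover from this have "\<mu> \<in> P n m" by (simp add: strictly_coarser_def)
    ultimately show "matrix_coeff n m (x_basis n m \<mu>) i k = (if \<mu> = ?K then 1 else 0 :: 'a)"
      using 1(1) by simp
  qed
  also have "\<dots> = of_bool (?K \<in> strictly_coarser n m \<pi>)"
    using fin by simp
  also have "of_bool (good_coloring \<pi> i k) - \<dots> = (of_bool (\<pi> = ?K) :: 'a)"
    unfolding good_coloring_iff_coarser[OF 1(2)] by (auto simp: strictly_coarser_def)
  finally show ?case .
qed

lemma matrix_coeff_omega:
  "matrix_coeff n n (omega n r t) i k = q_coeff n (kernel n n i k) r t"
proof -
  have "matrix_coeff n n (omega n r t) i k =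
      (\<Sum>\<pi>\<in>P n n. q_coeff n \<pi> r t * matrix_coeff n n (x_basis n n \<pi>) i k)"
    unfolding omega_def by (rule matrix_coeff_sum)
  also have "\<dots> = (\<Sum>\<pi>\<in>P n n. if \<pi> = kernel n n i k then q_coeff n (kernel n n i k) r t else 0)"
    by (rule sum.cong) (auto simp: matrix_coeff_x_basis)
  also have "\<dots> = q_coeff n (kernel n n i k) r t"
    using kernel_in_P finite_P by simp
  finally show ?thesis .
qed

section \<open>The map f as a matrix, and its faithfulness\<close>

lemma finite_index_functions: "finite (index_functions n d)"
  unfolding index_functions_def by (intro finite_PiE) auto

lemma f_map_eq_matrix_coeff:
  "f_map n m d g w k =
    (if k \<in> index_functions m d then \<Sum>i\<in>index_functions n d. w i * matrix_coeff n m g i k else 0)"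
proof -
  have inner: "(\<Sum>i' | i' \<in> index_functions m d \<and> good_coloring \<pi> i i'. basis_vec i' k) =
      (if k \<in> index_functions m d \<and> good_coloring \<pi> i k then 1 else 0 :: 'a)" for \<pi> i
    using finite_index_functions[of m d] by (simp add: basis_vec_def)
  have "f_map n m d g w k = (\<Sum>i\<in>index_functions n d. \<Sum>\<pi>\<in>P n m.
      if k \<in> index_functions m d then w i * (if good_coloring \<pi> i k then g \<pi> else 0) else 0)"
    unfolding f_map_def inner by (subst sum.swap) (intro sum.cong; simp)
  then show ?thesis
    unfolding matrix_coeff_def sum_distrib_left by simp
qed

text \<open>Colour the parts of the given diagram by distinct colours; the other contributing diagrams
  are then strictly finer, hence have more parts.\<close>

lemma FP_eqI:
  assumes "g \<in> FP n m" "h \<in> FP n m" "n + m \<le> d"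
    and eq: "\<And>i k. i \<in> index_functions n d \<Longrightarrow> k \<in> index_functions m d \<Longrightarrow>
      matrix_coeff n m g i k = matrix_coeff n m h i k"
  shows "g = h"
proof
  fix \<rho>
  show "g \<rho> = h \<rho>"
  proof (cases "\<rho> \<in> P n m")
    case False
    then show ?thesis using assms(1,2) by (simp add: FP_def span_on_def)
  next
    case True
    then show ?thesis
    proof (induction "card {\<pi> \<in> P n m. refines (vertices n m) \<pi> \<rho>}" arbitrary: \<rho> rule: less_induct)
      case less
      let ?V = "vertices n m"
      have \<rho>: "partition_on ?V \<rho>" using less.prems by (simp add: P_def)
      have finV: "finite ?V" by (rule finite_vertices)
      have cardV: "card ?V \<le> d"
      proof -
        have "card ?V \<le> card (Unprimed ` {1..n}) + card (Primed ` {1..m})"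
          unfolding vertices_def by (rule card_Un_le)
        also have "\<dots> \<le> n + m" by (metis add_mono card_atLeastAtMost card_image_le diff_Suc_1 finite_atLeastAtMost One_nat_def)
        finally show ?thesis using assms(3) by simp
      qed
      define part where "part v = (THE B. B \<in> \<rho> \<and> v \<in> B)" for v
      have part: "part v = B" if "B \<in> \<rho>" "v \<in> B" for v B
        unfolding part_def using that partition_onD2[OF \<rho>]
        by (intro the_equality) (auto simp: disjoint_def)
      have fin\<rho>: "finite \<rho>" using finV \<rho> by (metis finite_elements)
      have part_mem: "part v \<in> \<rho>" "v \<in> part v" if v: "v \<in> ?V" for v
      proof -
        obtain B where "B \<in> \<rho>" "v \<in> B" using v \<rho> unfolding partition_on_def by blast
        then show "part v \<in> \<rho>" "v \<in> part v" using part by auto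
      qed
      have "\<rho> \<subseteq> part ` ?V"
      proof
        fix B assume B: "B \<in> \<rho>"
        then obtain v where "v \<in> B" using \<rho> unfolding partition_on_def by fastforce
        moreover have "v \<in> ?V" using B calculation \<rho> unfolding partition_on_def by blast
        ultimately show "B \<in> part ` ?V" using part B by blast
      qed
      then have "card \<rho> \<le> card ?V" using finV by (rule surj_card_le[rotated])
      then have "card \<rho> \<le> d" using cardV by simp
      \<comment> \<open>A diagram has at most as many parts as there are vertices,
        \<open>n + m\<close>; this is where \<open>d\<close> has to be that large.\<close>
      then obtain col where col: "inj_on col \<rho>" "col ` \<rho> \<subseteq> {1..d}"
        using card_le_inj[OF fin\<rho>, of "{1..d}"] by auto
      define i where "i = (\<lambda>j\<in>{1..n}. col (part (Unprimed j)))"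
      define k where "k = (\<lambda>j\<in>{1..m}. col (part (Primed j)))"
      have color: "color i k v = col (part v)" if "v \<in> ?V" for v
        using that by (auto simp: i_def k_def vertices_def)
      have ik: "i \<in> index_functions n d" "k \<in> index_functions m d"
        using col(2) part_mem by (auto simp: i_def k_def index_functions_def vertices_def)
      have "perfect_coloring \<rho> i k"
        unfolding perfect_coloring_def
      proof (intro ballI)
        fix x y assume "x \<in> \<Union>\<rho>" "y \<in> \<Union>\<rho>"
        then have xy: "x \<in> ?V" "y \<in> ?V" using \<rho> by (auto simp: partition_on_def)
        have "color i k x = color i k y \<longleftrightarrow> part x = part y"
          using color xy col(1) part_mem by (auto dest: inj_onD)
        also have "\<dots> \<longleftrightarrow> (\<exists>B\<in>\<rho>. x \<in> B \<and> y \<in> B)"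
          using part part_mem xy by metis
        finally show "color i k x = color i k y \<longleftrightarrow> (\<exists>B\<in>\<rho>. x \<in> B \<and> y \<in> B)" .
      qed
      then have ker: "\<rho> = kernel n m i k" using perfect_coloring_iff_kernel less.prems by blast
      \<comment> \<open>Since \<open>\<rho>\<close> is the kernel of the colouring, the contributing
        diagrams are its refinements, and the induction hypothesis covers all of them except
        \<open>\<rho>\<close> itself.\<close>
      have split: "matrix_coeff n m u i k =
          u \<rho> + (\<Sum>\<pi>\<in>{\<pi> \<in> P n m. refines ?V \<pi> \<rho>} - {\<rho>}. u \<pi>)" for u :: "diagram \<Rightarrow> 'a"
      proof -
        have "matrix_coeff n m u i k = (\<Sum>\<pi>\<in>{\<pi> \<in> P n m. refines ?V \<pi> \<rho>}. u \<pi>)"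
          unfolding matrix_coeff_def using finite_P
          by (simp add: sum.inter_filter ker good_coloring_iff_refines cong: sum.cong)
        also have "\<dots> = u \<rho> + (\<Sum>\<pi>\<in>{\<pi> \<in> P n m. refines ?V \<pi> \<rho>} - {\<rho>}. u \<pi>)"
          using finite_P less.prems refines_refl[OF \<rho>] by (intro sum.remove) auto
        finally show ?thesis .
      qed
      have "g \<pi> = h \<pi>" if "\<pi> \<in> {\<pi> \<in> P n m. refines ?V \<pi> \<rho>} - {\<rho>}" for \<pi>
      proof (rule less.hyps)
        show "\<pi> \<in> P n m" using that by blast
        have "{\<mu> \<in> P n m. refines ?V \<mu> \<pi>} \<subseteq> {\<mu> \<in> P n m. refines ?V \<mu> \<rho>}"
          using that refines_trans by blast
        moreover have "\<rho> \<in> {\<mu> \<in> P n m. refines ?V \<mu> \<rho>}" "\<not> refines ?V \<rho> \<pi>"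
          using that less.prems refines_refl[OF \<rho>] refines_asym by blast+
        ultimately show "card {\<mu> \<in> P n m. refines ?V \<mu> \<pi>} < card {\<mu> \<in> P n m. refines ?V \<mu> \<rho>}"
          using finite_P by (intro psubset_card_mono) auto
      qed
      then have "(\<Sum>\<pi>\<in>{\<pi> \<in> P n m. refines ?V \<pi> \<rho>} - {\<rho>}. g \<pi>) =
          (\<Sum>\<pi>\<in>{\<pi> \<in> P n m. refines ?V \<pi> \<rho>} - {\<rho>}. h \<pi>)"
        by (rule sum.cong[OF refl])
      then show ?case using eq[OF ik] unfolding split by simp
    qed
  qed
qed

section \<open>Composition of diagrams\<close>

text \<open>The function is arbitrary so that the notion serves twice: for a colouring it expresses
  goodness, and for a membership predicate it says that the set is a union of parts.\<close>

definition part_constant :: "'a set set \<Rightarrow> ('a \<Rightarrow> 'b) \<Rightarrow> bool" where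
  "part_constant Q h \<longleftrightarrow> (\<forall>B\<in>Q. \<forall>x\<in>B. \<forall>y\<in>B. h x = h y)"

lemma partition_on_components_of: "partition_on (\<Union>\<E>) (components_of \<E>)"
proof -
  define U where "U = \<Union>\<E>"
  define R where "R = {(x, y). \<exists>B\<in>\<E>. x \<in> B \<and> y \<in> B}\<^sup>*"
  have "sym R" unfolding R_def by (intro sym_rtrancl) (auto intro: symI)
  have "trans R" unfolding R_def by (rule trans_rtrancl)
  have "refl R" unfolding R_def by (rule refl_rtrancl)
  have closed: "y \<in> U" if "(x, y) \<in> R" "x \<in> U" for x y
    using that unfolding R_def U_def by induction auto
  \<comment> \<open>The closure in \<open>components_of\<close> is reflexive on the whole type, so
    it has to be cut down to an equivalence on \<open>U\<close>. Since \<open>R\<close> does not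
    lead out of \<open>U\<close>, the classes of points of \<open>U\<close> stay the same.\<close>
  have "equiv U (R \<inter> (U \<times> U))"
  proof (rule equivI)
    show "refl_on U (R \<inter> (U \<times> U))" using \<open>refl R\<close> by (auto simp: refl_on_def)
    show "sym (R \<inter> (U \<times> U))" using \<open>sym R\<close> by (auto simp: sym_def)
    show "trans (R \<inter> (U \<times> U))" using \<open>trans R\<close> by (intro trans_Int) (auto intro: transI)
  qed auto
  then have "partition_on U (U // (R \<inter> (U \<times> U)))"
    by (rule partition_on_quotient)
  also have "U // (R \<inter> (U \<times> U)) = U // R"
    unfolding quotient_def
  proof (rule SUP_cong[OF refl])
    fix x assume "x \<in> U"
    then have "(R \<inter> (U \<times> U)) `` {x} = R `` {x}"
      using closed by auto
    then show "{(R \<inter> (U \<times> U)) `` {x}} = {R `` {x}}" by simp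
  qed
  finally show ?thesis by (simp only: components_of_def U_def R_def)
qed

text \<open>Constancy passes along paths. Thus a condition on connected components can be tested on
  the edges or parts that generate them.\<close>

lemma part_constant_components_of: "part_constant (components_of \<E>) h \<longleftrightarrow> part_constant \<E> h"
proof
  let ?R = "{(x, y). \<exists>B\<in>\<E>. x \<in> B \<and> y \<in> B}"
  assume *: "part_constant (components_of \<E>) h"
  show "part_constant \<E> h"
    unfolding part_constant_def
  proof (intro ballI)
    fix B x y assume B: "B \<in> \<E>" "x \<in> B" "y \<in> B"
    then have "?R\<^sup>* `` {x} \<in> components_of \<E>"
      unfolding components_of_def by (intro quotientI UnionI)
    moreover have "(x, y) \<in> ?R\<^sup>*" using B by (intro r_into_rtrancl CollectI case_prodI bexI conjI)
    ultimately show "h x = h y" using * unfolding part_constant_def by (meson Image_singleton_iff rtrancl.rtrancl_refl)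
  qed
next
  let ?R = "{(x, y). \<exists>B\<in>\<E>. x \<in> B \<and> y \<in> B}"
  assume *: "part_constant \<E> h"
  have const: "h x = h y" if "(x, y) \<in> ?R\<^sup>*" for x y
    using that
  proof induction
    case (step y z)
    then obtain B where "B \<in> \<E>" "y \<in> B" "z \<in> B" by (elim CollectE case_prodE bexE conjE) simp
    then show ?case using * step.IH unfolding part_constant_def by metis
  qed simp
  show "part_constant (components_of \<E>) h"
    unfolding part_constant_def
  proof (intro ballI)
    fix C x y assume C: "C \<in> components_of \<E>" "x \<in> C" "y \<in> C"
    then obtain z where "C = ?R\<^sup>* `` {z}" unfolding components_of_def by (elim quotientE) simp
    then have "(z, x) \<in> ?R\<^sup>*" "(z, y) \<in> ?R\<^sup>*" using C(2,3) by simp_all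
    from const[OF this(1)] const[OF this(2)] show "h x = h y" by (rule trans[OF sym])
  qed
qed

text \<open>A set whose membership predicate is constant on parts is a union of parts, and it
  determines which ones.\<close>

lemma card_saturated_subsets:
  assumes Q: "partition_on W Q" and "finite W"
  shows "card {A. A \<subseteq> W \<and> part_constant Q (\<lambda>x. x \<in> A)} = 2 ^ card Q"
proof -
  have un: "\<Union>Q = W" and dj: "\<And>B C x. B \<in> Q \<Longrightarrow> C \<in> Q \<Longrightarrow> x \<in> B \<Longrightarrow> x \<in> C \<Longrightarrow> B = C"
    and ne: "\<And>B. B \<in> Q \<Longrightarrow> B \<noteq> {}"
    using Q unfolding partition_on_def disjoint_def by auto
  have "bij_betw Union (Pow Q) {A. A \<subseteq> W \<and> part_constant Q (\<lambda>x. x \<in> A)}"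
  proof (rule bij_betw_byWitness[where f' = "\<lambda>A. {B \<in> Q. B \<subseteq> A}"])
    show "\<forall>R\<in>Pow Q. {B \<in> Q. B \<subseteq> \<Union>R} = R"
    proof (intro ballI equalityI subsetI)
      fix R B assume "R \<in> Pow Q" "B \<in> {B \<in> Q. B \<subseteq> \<Union>R}"
      then have B: "R \<subseteq> Q" "B \<in> Q" "B \<subseteq> \<Union>R" by simp_all
      obtain x where "x \<in> B" using ne[OF B(2)] by auto
      then obtain C where "C \<in> R" "x \<in> C" using B(3) by auto
      then show "B \<in> R" using dj[OF B(2) _ \<open>x \<in> B\<close>, of C] B(1) by auto
    qed auto
    show "\<forall>A\<in>{A. A \<subseteq> W \<and> part_constant Q (\<lambda>x. x \<in> A)}. \<Union> {B \<in> Q. B \<subseteq> A} = A"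
    proof (intro ballI equalityI subsetI)
      fix A x assume "A \<in> {A. A \<subseteq> W \<and> part_constant Q (\<lambda>x. x \<in> A)}" "x \<in> A"
      then have A: "A \<subseteq> W" "part_constant Q (\<lambda>x. x \<in> A)" by simp_all
      obtain B where B: "B \<in> Q" "x \<in> B" using A(1) \<open>x \<in> A\<close> un by auto
      have "B \<subseteq> A"
        using A(2) B \<open>x \<in> A\<close> unfolding part_constant_def by (metis subsetI)
      then show "x \<in> \<Union> {B \<in> Q. B \<subseteq> A}" using B by auto
    qed auto
    show "Union ` Pow Q \<subseteq> {A. A \<subseteq> W \<and> part_constant Q (\<lambda>x. x \<in> A)}"
    proof (intro image_subsetI CollectI conjI)
      fix R assume R: "R \<in> Pow Q"
      then show "\<Union>R \<subseteq> W" using un by auto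
      show "part_constant Q (\<lambda>x. x \<in> \<Union>R)"
        unfolding part_constant_def
      proof (intro ballI)
        fix B x y assume B: "B \<in> Q" "x \<in> B" "y \<in> B"
        have "z \<in> \<Union>R \<longleftrightarrow> B \<in> R" if "z \<in> B" for z
          using dj[OF B(1) _ that] that R by auto
        then show "x \<in> \<Union>R \<longleftrightarrow> y \<in> \<Union>R" using B(2,3) by simp
      qed
    qed
    show "(\<lambda>A. {B \<in> Q. B \<subseteq> A}) ` {A. A \<subseteq> W \<and> part_constant Q (\<lambda>x. x \<in> A)} \<subseteq> Pow Q" by auto
  qed
  then have "card {A. A \<subseteq> W \<and> part_constant Q (\<lambda>x. x \<in> A)} = card (Pow Q)"
    by (rule bij_betw_same_card[symmetric])
  also have "\<dots> = 2 ^ card Q" using Q assms(2) by (intro card_Pow) (rule finite_elements)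
  finally show ?thesis .
qed

lemma card_components_of:
  assumes "finite (\<Union>\<E>)"
  shows "card {A. A \<subseteq> \<Union>\<E> \<and> part_constant \<E> (\<lambda>x. x \<in> A)} = 2 ^ card (components_of \<E>)"
  using card_saturated_subsets[OF partition_on_components_of assms]
  by (simp add: part_constant_components_of)

text \<open>Such an extension takes one value on each part. Parts that meet \<open>X\<close> have
  their value forced by \<open>y\<close>, consistently by assumption; every other part has a free
  choice in \<open>D\<close>.\<close>

lemma card_part_constant_extensions:
  assumes Q: "partition_on W Q" and fin: "finite W" and X: "X \<subseteq> W"
    and y: "part_constant ((\<inter>) X ` Q) y" "y ` X \<subseteq> D"
  shows "card {h \<in> W \<rightarrow>\<^sub>E D. part_constant Q h \<and> (\<forall>x\<in>X. h x = y x)} =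
    card D ^ card {B \<in> Q. B \<inter> X = {}}"
proof -
  \<comment> \<open>The values available on the part \<open>B\<close>; if \<open>B\<close> meets
    \<open>X\<close>, this is the single value that \<open>y\<close> takes there.\<close>
  define T where "T B = (if B \<inter> X = {} then D else y ` (B \<inter> X))" for B
  have un: "\<Union>Q = W" and dj: "\<And>B C x. B \<in> Q \<Longrightarrow> C \<in> Q \<Longrightarrow> x \<in> B \<Longrightarrow> x \<in> C \<Longrightarrow> B = C"
    and ne: "\<And>B. B \<in> Q \<Longrightarrow> B \<noteq> {}"
    using Q unfolding partition_on_def disjoint_def by auto
  have finQ: "finite Q" using fin Q by (rule finite_elements)
  define part where "part v = (THE B. B \<in> Q \<and> v \<in> B)" for v
  have part: "part v = B" if "B \<in> Q" "v \<in> B" for v B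
    unfolding part_def using that dj by (intro the_equality) auto
  have part_mem: "part v \<in> Q" "v \<in> part v" if v: "v \<in> W" for v
  proof -
    obtain B where "B \<in> Q" "v \<in> B" using v un by auto
    then show "part v \<in> Q" "v \<in> part v" using part by auto
  qed
  have TX: "T B = {y x}" if "B \<in> Q" "x \<in> B" "x \<in> X" for B x
  proof -
    note yc = bspec[OF y(1)[unfolded part_constant_def] imageI[OF that(1)]]
    have "y u \<in> {y x}" if "u \<in> B \<inter> X" for u
      using bspec[OF bspec[OF yc, of u], of x] that \<open>x \<in> B\<close> \<open>x \<in> X\<close> by simp
    then have "y ` (B \<inter> X) \<subseteq> {y x}" by (rule image_subsetI)
    moreover have "{y x} \<subseteq> y ` (B \<inter> X)" using that by simp
    ultimately have "y ` (B \<inter> X) = {y x}" by (rule equalityI)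
    then show ?thesis using that by (auto simp: T_def)
  qed
  have TD: "T B \<subseteq> D" for B using y(2) unfolding T_def by auto
  define rep where "rep B = (SOME v. v \<in> B)" for B :: "'a set"
  have rep: "rep B \<in> B" if "B \<in> Q" for B unfolding rep_def using ne[OF that] by (simp add: some_in_eq)
  have sub: "B \<subseteq> W" if "B \<in> Q" for B using that un by auto
  let ?H = "{h \<in> W \<rightarrow>\<^sub>E D. part_constant Q h \<and> (\<forall>x\<in>X. h x = y x)}"
  have "bij_betw (\<lambda>G. \<lambda>v\<in>W. G (part v)) (PiE Q T) ?H"
  proof (rule bij_betw_byWitness[where f' = "\<lambda>h. \<lambda>B\<in>Q. h (rep B)"])
    show "\<forall>G\<in>PiE Q T. (\<lambda>B\<in>Q. (\<lambda>v\<in>W. G (part v)) (rep B)) = G"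
    proof (intro ballI ext)
      fix G B assume G: "G \<in> PiE Q T"
      show "(\<lambda>B\<in>Q. (\<lambda>v\<in>W. G (part v)) (rep B)) B = G B"
      proof (cases "B \<in> Q")
        case True
        then show ?thesis using rep[OF True] sub[OF True] part[OF True] by auto
      next
        case False
        then show ?thesis using PiE_arb[OF G False] by simp
      qed
    qed
    show "\<forall>h\<in>?H. (\<lambda>v\<in>W. (\<lambda>B\<in>Q. h (rep B)) (part v)) = h"
    proof (intro ballI ext)
      fix h v assume "h \<in> ?H"
      then have h: "h \<in> W \<rightarrow>\<^sub>E D" "part_constant Q h" by simp_all
      show "(\<lambda>v\<in>W. (\<lambda>B\<in>Q. h (rep B)) (part v)) v = h v"
      proof (cases "v \<in> W")
        case True
        have "h (rep (part v)) = h v"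
          using h(2) part_mem[OF True] rep[OF part_mem(1)[OF True]] unfolding part_constant_def by metis
        then show ?thesis using True part_mem(1)[OF True] by simp
      next
        case False
        then show ?thesis using PiE_arb[OF h(1) False] by simp
      qed
    qed
    show "(\<lambda>G. \<lambda>v\<in>W. G (part v)) ` PiE Q T \<subseteq> ?H"
    proof (intro image_subsetI CollectI conjI ballI)
      fix G assume G: "G \<in> PiE Q T"
      have GT: "G (part v) \<in> T (part v)" if "v \<in> W" for v using G part_mem(1)[OF that] by (rule PiE_mem)
      then show "(\<lambda>v\<in>W. G (part v)) \<in> W \<rightarrow>\<^sub>E D" using TD by auto
      show "part_constant Q (\<lambda>v\<in>W. G (part v))"
        unfolding part_constant_def
      proof (intro ballI)
        fix B u v assume B: "B \<in> Q" "u \<in> B" "v \<in> B"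
        then have "u \<in> W" "v \<in> W" "part u = part v" using sub part[OF B(1)] by auto
        then show "(\<lambda>v\<in>W. G (part v)) u = (\<lambda>v\<in>W. G (part v)) v" by simp
      qed
      fix x assume "x \<in> X"
      then have "x \<in> W" using X by auto
      then show "(\<lambda>v\<in>W. G (part v)) x = y x"
        using GT[of x] TX[OF part_mem[OF \<open>x \<in> W\<close>] \<open>x \<in> X\<close>] by simp
    qed
    show "(\<lambda>h. \<lambda>B\<in>Q. h (rep B)) ` ?H \<subseteq> PiE Q T"
    proof (intro image_subsetI PiE_I)
      fix h B assume "h \<in> ?H" and B: "B \<in> Q"
      then have h: "h \<in> W \<rightarrow>\<^sub>E D" "part_constant Q h" "\<And>x. x \<in> X \<Longrightarrow> h x = y x" by simp_all
      have "h (rep B) \<in> T B"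
      proof (cases "B \<inter> X = {}")
        case True
        then show ?thesis using h(1) rep[OF B] sub[OF B] unfolding T_def by auto
      next
        case False
        then obtain x where x: "x \<in> B" "x \<in> X" by auto
        then have "h (rep B) = h x" using h(2) B rep[OF B] unfolding part_constant_def by metis
        then show ?thesis using TX[OF B x] h(3)[OF x(2)] by simp
      qed
      then show "(\<lambda>B\<in>Q. h (rep B)) B \<in> T B" using B by simp
    qed simp
  qed
  then have "card ?H = card (PiE Q T)" by (rule bij_betw_same_card[symmetric])
  also have "\<dots> = (\<Prod>B\<in>Q. card (T B))" using finQ by (rule card_PiE)
  also have "\<dots> = (\<Prod>B\<in>Q. if B \<inter> X = {} then card D else 1)"
  proof (rule prod.cong[OF refl])
    fix B assume B: "B \<in> Q"
    show "card (T B) = (if B \<inter> X = {} then card D else 1)"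
    proof (cases "B \<inter> X = {}")
      case True
      then show ?thesis by (simp add: T_def)
    next
      case False
      then obtain x where x: "x \<in> B" "x \<in> X" by auto
      then show ?thesis using TX[OF B x] False by simp
    qed
  qed
  also have "\<dots> = card D ^ card {B \<in> Q. B \<inter> X = {}}"
    using finQ by (simp add: prod.If_cases Int_def)
  finally show ?thesis .
qed

section \<open>Colourings of glued diagrams\<close>

fun tricolor :: "(nat \<Rightarrow> nat) \<Rightarrow> (nat \<Rightarrow> nat) \<Rightarrow> (nat \<Rightarrow> nat) \<Rightarrow> vertex \<Rightarrow> nat" where
  "tricolor i s k (Unprimed j) = i j"
| "tricolor i s k (Doubly j) = s j"
| "tricolor i s k (Primed j) = k j"

lemma part_constant_image: "part_constant ((`) g ` Q) h \<longleftrightarrow> part_constant Q (\<lambda>x. h (g x))"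
  by (simp add: part_constant_def)

lemma part_constant_cong:
  assumes "\<And>x. x \<in> \<Union>Q \<Longrightarrow> h x = h' x"
  shows "part_constant Q h \<longleftrightarrow> part_constant Q h'"
proof -
  have "(h x = h y) = (h' x = h' y)" if "B \<in> Q" "x \<in> B" "y \<in> B" for B x y
    using assms[OF UnionI[OF that(1,2)]] assms[OF UnionI[OF that(1,3)]] by simp
  then show ?thesis unfolding part_constant_def by (intro ball_cong refl)
qed

lemma part_constant_Un: "part_constant (Q \<union> R) h \<longleftrightarrow> part_constant Q h \<and> part_constant R h"
  by (simp add: part_constant_def ball_Un)

lemma part_constant_Diff_empty: "part_constant (Q - {{}}) h \<longleftrightarrow> part_constant Q h"
proof
  assume *: "part_constant (Q - {{}}) h"
  show "part_constant Q h"
    unfolding part_constant_def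
  proof (intro ballI)
    fix B x y assume "B \<in> Q" "x \<in> B" "y \<in> B"
    then have "B \<in> Q - {{}}" by auto
    then show "h x = h y" using * \<open>x \<in> B\<close> \<open>y \<in> B\<close> unfolding part_constant_def by blast
  qed
qed (use DiffD1 in \<open>unfold part_constant_def, blast\<close>)

lemma good_coloring_eq_part_constant: "good_coloring \<pi> i k \<longleftrightarrow> part_constant \<pi> (color i k)"
  by (simp add: good_coloring_def part_constant_def)

lemma Union_P: "\<pi> \<in> P n m \<Longrightarrow> \<Union>\<pi> = vertices n m"
  by (auto simp: P_def partition_on_def)

context
  fixes n m l :: nat and \<pi> \<mu> :: diagram
  assumes \<pi>: "\<pi> \<in> P n m" and \<mu>: "\<mu> \<in> P m l"
begin

lemma partition_on_star:
  "partition_on (vertices n l \<union> Doubly ` {1..m}) (star \<mu> \<pi>)"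
proof -
  have "\<Union> ((`) glue_top ` \<pi> \<union> (`) glue_bottom ` \<mu>) = glue_top ` \<Union>\<pi> \<union> glue_bottom ` \<Union>\<mu>"
    by auto
  also have "\<dots> = vertices n l \<union> Doubly ` {1..m}"
    unfolding Union_P[OF \<pi>] Union_P[OF \<mu>] vertices_def image_Un image_image by auto
  finally show ?thesis
    unfolding star_def using partition_on_components_of by metis
qed

lemma star_part_outer:
  assumes "B \<in> star \<mu> \<pi>"
  shows "B - range Doubly = vertices n l \<inter> B"
proof -
  have "B \<subseteq> vertices n l \<union> Doubly ` {1..m}"
    using partition_on_star assms by (auto simp: partition_on_def)
  moreover have "vertices n l \<inter> range Doubly = {}" by (auto simp: vertices_def)
  ultimately show ?thesis by auto
qed

lemma dot_eq: "dot \<mu> \<pi> = (\<inter>) (vertices n l) ` star \<mu> \<pi> - {{}}"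
  unfolding dot_def using star_part_outer by (simp cong: image_cong)

lemma dot_in_P: "dot \<mu> \<pi> \<in> P n l"
proof -
  have "vertices n l \<inter> (vertices n l \<union> Doubly ` {1..m}) = vertices n l" by auto
  then show ?thesis
    using partition_on_restrict[OF partition_on_star, of "vertices n l"]
    unfolding dot_eq P_def by simp
qed

lemma good_coloring_dot:
  "good_coloring (dot \<mu> \<pi>) i k \<longleftrightarrow> part_constant ((\<inter>) (vertices n l) ` star \<mu> \<pi>) (color i k)"
  unfolding good_coloring_eq_part_constant dot_eq by (rule part_constant_Diff_empty)

lemma loops_eq: "loops \<mu> \<pi> = card {B \<in> star \<mu> \<pi>. B \<inter> vertices n l = {}}"
  unfolding loops_def using star_part_outer
  by (intro arg_cong[of _ _ card] Collect_cong conj_cong refl) (metis Diff_eq_empty_iff Int_commute)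

text \<open>Constancy on the glued components is tested on the two diagrams separately, where the
  three-row colouring restricts to \<open>(i, s)\<close> on \<open>\<pi>\<close> and to
  \<open>(s, k)\<close> on \<open>\<mu>\<close>.\<close>

lemma part_constant_star:
  "part_constant (star \<mu> \<pi>) (tricolor i s k) \<longleftrightarrow> good_coloring \<pi> i s \<and> good_coloring \<mu> s k"
proof -
  have "part_constant \<pi> (\<lambda>x. tricolor i s k (glue_top x)) \<longleftrightarrow> part_constant \<pi> (color i s)"
    by (rule part_constant_cong) (auto simp: Union_P[OF \<pi>] vertices_def)
  moreover have "part_constant \<mu> (\<lambda>x. tricolor i s k (glue_bottom x)) \<longleftrightarrow> part_constant \<mu> (color s k)"
    by (rule part_constant_cong) (auto simp: Union_P[OF \<mu>] vertices_def)
  ultimately show ?thesis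
    unfolding star_def part_constant_components_of part_constant_Un part_constant_image
      good_coloring_eq_part_constant by simp
qed

lemma tricolor_outer: "x \<in> vertices n l \<Longrightarrow> tricolor i s k x = color i k x"
  by (auto simp: vertices_def)

text \<open>A middle row \<open>s\<close> that fits both diagrams is an extension of the outer
  colouring that is constant on the parts of \<open>star \<mu> \<pi>\<close>. It exists iff the
  outer colouring is constant on the traces of these parts, that is, good for
  \<open>dot \<mu> \<pi>\<close>; then each part inside the middle row can still take any of
  \<open>d\<close> colours.\<close>

lemma card_middle_colorings:
  assumes i: "i \<in> index_functions n d" and k: "k \<in> index_functions l d"
  shows "card {s \<in> index_functions m d. good_coloring \<pi> i s \<and> good_coloring \<mu> s k} =
    (if good_coloring (dot \<mu> \<pi>) i k then d ^ loops \<mu> \<pi> else 0)"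
proof -
  let ?X = "vertices n l"
  let ?W = "?X \<union> Doubly ` {1..m}"
  let ?M = "{s \<in> index_functions m d. good_coloring \<pi> i s \<and> good_coloring \<mu> s k}"
  let ?H = "{h \<in> ?W \<rightarrow>\<^sub>E {1..d}. part_constant (star \<mu> \<pi>) h \<and> (\<forall>x\<in>?X. h x = color i k x)}"
  have un: "\<Union> (star \<mu> \<pi>) = ?W" using partition_on_star by (simp add: partition_on_def)
  have colD: "color i k ` ?X \<subseteq> {1..d}"
    using i k by (auto simp: vertices_def index_functions_def)
  show ?thesis
  proof (cases "good_coloring (dot \<mu> \<pi>) i k")
    case True
    have "bij_betw (\<lambda>s. restrict (tricolor i s k) ?W) ?M ?H"
    proof (rule bij_betw_byWitness[where f' = "\<lambda>h. \<lambda>j\<in>{1..m}. h (Doubly j)"])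
      show "\<forall>s\<in>?M. (\<lambda>j\<in>{1..m}. restrict (tricolor i s k) ?W (Doubly j)) = s"
      proof (intro ballI ext)
        fix s j assume "s \<in> ?M"
        then have "s \<in> {1..m} \<rightarrow>\<^sub>E {1..d}" by (simp add: index_functions_def)
        then have "s j = undefined" if "j \<notin> {1..m}" using that by (rule PiE_arb)
        then show "(\<lambda>j\<in>{1..m}. restrict (tricolor i s k) ?W (Doubly j)) j = s j"
          by (cases "j \<in> {1..m}") (simp_all add: restrict_def)
      qed
      have ext: "restrict (tricolor i (\<lambda>j\<in>{1..m}. h (Doubly j)) k) ?W = h"
        if h: "h \<in> ?W \<rightarrow>\<^sub>E {1..d}" "\<forall>x\<in>?X. h x = color i k x" for h
      proof
        fix v
        consider "v \<in> ?X" | j where "j \<in> {1..m}" "v = Doubly j" | "v \<notin> ?W"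
          by (metis Un_iff imageE)
        then show "restrict (tricolor i (\<lambda>j\<in>{1..m}. h (Doubly j)) k) ?W v = h v"
        proof cases
          case 1
          then show ?thesis using h(2) tricolor_outer[OF 1] by simp
        next
          case 2
          then show ?thesis by simp
        next
          case 3
          then show ?thesis using PiE_arb[OF h(1) 3] unfolding restrict_def by simp
        qed
      qed
      then show "\<forall>h\<in>?H. restrict (tricolor i (\<lambda>j\<in>{1..m}. h (Doubly j)) k) ?W = h" by simp
      show "(\<lambda>s. restrict (tricolor i s k) ?W) ` ?M \<subseteq> ?H"
      proof (intro image_subsetI CollectI conjI ballI)
        fix s assume "s \<in> ?M"
        then have s: "s \<in> index_functions m d" "part_constant (star \<mu> \<pi>) (tricolor i s k)"
          by (simp_all add: part_constant_star)
        show "restrict (tricolor i s k) ?W \<in> ?W \<rightarrow>\<^sub>E {1..d}"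
        proof (intro PiE_I)
          fix v assume "v \<in> ?W"
          moreover have "tricolor i s k v \<in> {1..d}" if "v \<in> ?X"
            using colD tricolor_outer[OF that] that by auto
          moreover have "tricolor i s k v \<in> {1..d}" if "v \<in> Doubly ` {1..m}"
            using s(1) that by (auto simp: index_functions_def)
          ultimately show "restrict (tricolor i s k) ?W v \<in> {1..d}" by auto
        qed (simp add: restrict_def)
        have "part_constant (star \<mu> \<pi>) (restrict (tricolor i s k) ?W) \<longleftrightarrow>
            part_constant (star \<mu> \<pi>) (tricolor i s k)"
          by (rule part_constant_cong) (simp add: un)
        then show "part_constant (star \<mu> \<pi>) (restrict (tricolor i s k) ?W)" using s(2) by simp
        show "restrict (tricolor i s k) ?W x = color i k x" if "x \<in> ?X" for x
          using that tricolor_outer[OF that] by simp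
      qed
      show "(\<lambda>h. \<lambda>j\<in>{1..m}. h (Doubly j)) ` ?H \<subseteq> ?M"
      proof (intro image_subsetI CollectI conjI)
        fix h assume "h \<in> ?H"
        then have h: "h \<in> ?W \<rightarrow>\<^sub>E {1..d}" "part_constant (star \<mu> \<pi>) h" "\<forall>x\<in>?X. h x = color i k x"
          by simp_all
        let ?s = "\<lambda>j\<in>{1..m}. h (Doubly j)"
        show "?s \<in> index_functions m d" using h(1) by (auto simp: index_functions_def)
        have "part_constant (star \<mu> \<pi>) (restrict (tricolor i ?s k) ?W)"
          unfolding ext[OF h(1,3)] by (rule h(2))
        moreover have "part_constant (star \<mu> \<pi>) (restrict (tricolor i ?s k) ?W) \<longleftrightarrow>
            part_constant (star \<mu> \<pi>) (tricolor i ?s k)"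
          by (rule part_constant_cong) (simp add: un)
        ultimately show "good_coloring \<pi> i ?s" "good_coloring \<mu> ?s k"
          using part_constant_star by simp_all
      qed
    qed
    then have "card ?M = card ?H" by (rule bij_betw_same_card)
    also have "\<dots> = card {1..d} ^ card {B \<in> star \<mu> \<pi>. B \<inter> ?X = {}}"
      using partition_on_star _ _ True[unfolded good_coloring_dot] colD
      by (rule card_part_constant_extensions) (auto simp: finite_vertices)
    finally show ?thesis using True by (simp add: loops_eq)
  next
    case False
    have "\<not> (good_coloring \<pi> i s \<and> good_coloring \<mu> s k)" for s
    proof
      assume "good_coloring \<pi> i s \<and> good_coloring \<mu> s k"
      then have c: "part_constant (star \<mu> \<pi>) (tricolor i s k)" by (simp add: part_constant_star)
      have "color i k x = color i k y" if "B \<in> star \<mu> \<pi>" "x \<in> ?X \<inter> B" "y \<in> ?X \<inter> B" for B x y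
      proof -
        have "tricolor i s k x = tricolor i s k y" using c that unfolding part_constant_def by blast
        then show ?thesis using tricolor_outer that by simp
      qed
      then have "part_constant ((\<inter>) ?X ` star \<mu> \<pi>) (color i k)"
        unfolding part_constant_def ball_simps(9) by (intro ballI)
      then show False using False good_coloring_dot by simp
    qed
    then have "?M = {}" by (intro Collect_empty_eq[THEN iffD2]) blast
    from arg_cong[OF this, of card] show ?thesis using False by (simp only: card.empty if_False)
  qed
qed

end

text \<open>Over \<open>d\<close> colours, the number of parts in the middle row turns into powers of \<open>t = d\<close>, so
  that composition becomes matrix multiplication.\<close>

lemma matrix_coeff_comp:
  fixes g h :: "diagram \<Rightarrow> 'a::field_char_0"
  assumes i: "i \<in> index_functions n d" and k: "k \<in> index_functions l d"
  shows "matrix_coeff n l (Rep0_comp (of_nat d) n m l g h) i k =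
    (\<Sum>s\<in>index_functions m d. matrix_coeff n m h i s * matrix_coeff m l g s k)"
proof -
  let ?I = "index_functions m d"
  have "matrix_coeff n l (Rep0_comp (of_nat d) n m l g h) i k =
      matrix_coeff n l (\<lambda>\<rho>. \<Sum>p\<in>P m l \<times> P n m. (g (fst p) * h (snd p) * of_nat d ^ loops (fst p) (snd p)) *
        basis_vec (dot (fst p) (snd p)) \<rho>) i k"
    unfolding Rep0_comp_def sum.cartesian_product by (simp add: case_prod_beta mult.assoc)
  also have "\<dots> = (\<Sum>p\<in>P m l \<times> P n m. (g (fst p) * h (snd p) * of_nat d ^ loops (fst p) (snd p)) *
        matrix_coeff n l (basis_vec (dot (fst p) (snd p))) i k)"
    by (rule matrix_coeff_sum)
  also have "\<dots> = (\<Sum>p\<in>P m l \<times> P n m. g (fst p) * h (snd p) *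
        of_nat (card {s \<in> ?I. good_coloring (snd p) i s \<and> good_coloring (fst p) s k}))"
  proof (rule sum.cong[OF refl])
    fix p assume "p \<in> P m l \<times> P n m"
    then have p: "snd p \<in> P n m" "fst p \<in> P m l" by auto
    show "(g (fst p) * h (snd p) * of_nat d ^ loops (fst p) (snd p)) *
        matrix_coeff n l (basis_vec (dot (fst p) (snd p))) i k = g (fst p) * h (snd p) *
        of_nat (card {s \<in> ?I. good_coloring (snd p) i s \<and> good_coloring (fst p) s k})"
      unfolding matrix_coeff_basis_vec[OF dot_in_P[OF p]] card_middle_colorings[OF p i k] by simp
  qed
  also have "\<dots> = (\<Sum>p\<in>P m l \<times> P n m. \<Sum>s\<in>?I. (if good_coloring (snd p) i s then h (snd p) else 0) *
        (if good_coloring (fst p) s k then g (fst p) else 0))"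
  proof (rule sum.cong[OF refl])
    fix p
    have "g (fst p) * h (snd p) * of_nat (card {s \<in> ?I. good_coloring (snd p) i s \<and> good_coloring (fst p) s k}) =
        (\<Sum>s\<in>{s \<in> ?I. good_coloring (snd p) i s \<and> good_coloring (fst p) s k}. h (snd p) * g (fst p))"
      by simp
    also have "\<dots> = (\<Sum>s\<in>?I. if good_coloring (snd p) i s \<and> good_coloring (fst p) s k
        then h (snd p) * g (fst p) else 0)"
      by (rule sum.inter_filter[OF finite_index_functions])
    finally show "g (fst p) * h (snd p) * of_nat (card {s \<in> ?I. good_coloring (snd p) i s \<and> good_coloring (fst p) s k}) =
        (\<Sum>s\<in>?I. (if good_coloring (snd p) i s then h (snd p) else 0) *
          (if good_coloring (fst p) s k then g (fst p) else 0))"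
      by (simp add: if_distrib[of "\<lambda>x. x * _"] if_distrib[of "\<lambda>x. _ * x"] cong: if_cong)
        (auto intro!: sum.cong)
  qed
  also have "\<dots> = (\<Sum>s\<in>?I. \<Sum>p\<in>P m l \<times> P n m. (if good_coloring (snd p) i s then h (snd p) else 0) *
        (if good_coloring (fst p) s k then g (fst p) else 0))"
    by (rule sum.swap)
  also have "\<dots> = (\<Sum>s\<in>?I. matrix_coeff n m h i s * matrix_coeff m l g s k)"
    unfolding matrix_coeff_def sum_product
    by (intro sum.cong refl, subst sum.swap) (simp add: sum.cartesian_product case_prod_beta)
  finally show ?thesis .
qed

section \<open>Counting cycles with prescribed values\<close>

text \<open>Points outside \<open>V\<close> are isolated, so each may be included or omitted
  freely.\<close>

lemma card_closed_subsets_supset: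
  assumes "finite X" "V \<subseteq> X" "E \<subseteq> V \<times> V"
  shows "card (closed_subsets X E) = 2 ^ card (X - V) * card (closed_subsets V E)"
proof -
  have edge: "u \<in> V" "v \<in> V" if "(u, v) \<in> E" for u v using assms(3) that by auto
  have "bij_betw (\<lambda>(A, B). A \<union> B) (Pow (X - V) \<times> closed_subsets V E) (closed_subsets X E)"
  proof (rule bij_betw_byWitness[where f' = "\<lambda>A. (A - V, A \<inter> V)"])
    show "\<forall>p\<in>Pow (X - V) \<times> closed_subsets V E. (\<lambda>A. (A - V, A \<inter> V)) ((\<lambda>(A, B). A \<union> B) p) = p"
      by (auto simp: closed_subsets_def)
    show "\<forall>A\<in>closed_subsets X E. (\<lambda>(A, B). A \<union> B) (A - V, A \<inter> V) = A" by auto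
    show "(\<lambda>(A, B). A \<union> B) ` (Pow (X - V) \<times> closed_subsets V E) \<subseteq> closed_subsets X E"
    proof (intro image_subsetI, clarify)
      fix A B assume A: "A \<subseteq> X - V" and B: "B \<in> closed_subsets V E"
      have "u \<in> A \<union> B \<longleftrightarrow> v \<in> A \<union> B" if uv: "(u, v) \<in> E" for u v
      proof -
        have "u \<notin> A" "v \<notin> A" using edge[OF uv] A by auto
        moreover have "u \<in> B \<longleftrightarrow> v \<in> B" using B uv unfolding closed_subsets_iff by simp
        ultimately show ?thesis by simp
      qed
      moreover have "A \<union> B \<subseteq> X" using A B assms(2) unfolding closed_subsets_def by auto
      ultimately show "A \<union> B \<in> closed_subsets X E" unfolding closed_subsets_iff by simp
    qed
    show "(\<lambda>A. (A - V, A \<inter> V)) ` closed_subsets X E \<subseteq> Pow (X - V) \<times> closed_subsets V E"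
    proof (intro image_subsetI SigmaI)
      fix A assume A: "A \<in> closed_subsets X E"
      then show "A - V \<in> Pow (X - V)" by (auto simp: closed_subsets_def)
      show "A \<inter> V \<in> closed_subsets V E"
        using A edge unfolding closed_subsets_iff by simp
    qed
  qed
  then have "card (closed_subsets X E) = card (Pow (X - V) \<times> closed_subsets V E)"
    by (rule bij_betw_same_card[symmetric])
  also have "\<dots> = 2 ^ card (X - V) * card (closed_subsets V E)"
    using assms(1) by (simp add: card_cartesian_product card_Pow)
  finally show ?thesis .
qed

lemma closed_subsets_Diff_Id: "closed_subsets X (E - Id) = closed_subsets X E"
proof -
  have "(\<forall>u v. (u, v) \<in> E - Id \<longrightarrow> (u \<in> A \<longleftrightarrow> v \<in> A)) \<longleftrightarrow> (\<forall>u v. (u, v) \<in> E \<longrightarrow> (u \<in> A \<longleftrightarrow> v \<in> A))" for A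
    by auto
  then show ?thesis by (intro set_eqI) (simp only: closed_subsets_iff)
qed

section \<open>Supports of cycles\<close>

definition loop_vertices :: "('a \<times> 'a) set \<Rightarrow> 'a set" where
  "loop_vertices E = {c. (c, c) \<in> E}"

definition moved_vertices :: "('a \<times> 'a) set \<Rightarrow> 'a set" where
  "moved_vertices E = Field E - loop_vertices E"

text \<open>Where the support of an \<open>r\<close>-cycle respecting \<open>E\<close> can lie: it
  avoids the colours that are prescribed to stay and contains every other colour of the graph, since
  these are forced to move.\<close>

definition admissible_supports :: "(nat \<times> nat) set \<Rightarrow> nat \<Rightarrow> nat \<Rightarrow> nat set set" where
  "admissible_supports E r d =
    {X. moved_vertices E \<subseteq> X \<and> X \<subseteq> {1..d} - loop_vertices E \<and> card X = r}"

lemma loop_vertices_subset: "loop_vertices E \<subseteq> Field E"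
  by (auto simp: loop_vertices_def Field_def)

lemma card_moved_vertices:
  assumes "finite E"
  shows "card (moved_vertices E) = card (Field E) - card (loop_vertices E)"
  unfolding moved_vertices_def using loop_vertices_subset finite_Field[OF assms]
  by (intro card_Diff_subset) (auto intro: finite_subset)

lemma respects_edgesD: "respects_edges E \<sigma> \<Longrightarrow> (u, v) \<in> E \<Longrightarrow> \<sigma> u = v"
  by (fastforce simp: respects_edges_def)

lemma respects_edgesI: "(\<And>u v. (u, v) \<in> E \<Longrightarrow> \<sigma> u = v) \<Longrightarrow> respects_edges E \<sigma>"
  by (auto simp: respects_edges_def)

text \<open>On a single point the only cyclic permutation is the identity, whose support is empty;
  hence the lower bound on \<open>card X\<close>.\<close>

lemma support_cyclic_perms:
  assumes "\<sigma> \<in> cyclic_perms X" "2 \<le> card X"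
  shows "{x. \<sigma> x \<noteq> x} = X"
proof -
  have \<sigma>: "\<sigma> permutes X" "cyclic_on \<sigma> X" using assms(1) by (simp_all add: cyclic_perms_def)
  have "\<sigma> x \<noteq> x" if "x \<in> X" for x
    using eq_on_cyclic_on_iff1[OF \<sigma>(2) that] assms(2) by auto
  moreover have "\<sigma> x = x" if "x \<notin> X" for x using \<sigma>(1) that by (simp add: permutes_def)
  ultimately show ?thesis by auto
qed

lemma r_cycle_cyclic_perms:
  assumes "\<sigma> \<in> r_cycles r d"
  shows "\<sigma> \<in> cyclic_perms {x. \<sigma> x \<noteq> x}"
proof -
  have "\<sigma> permutes {1..d}" "cyclic_on \<sigma> {x. \<sigma> x \<noteq> x}" using assms by (simp_all add: r_cycles_def)
  moreover have "\<sigma> permutes {x. \<sigma> x \<noteq> x}"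
    using calculation(1) by (rule permutes_superset) simp
  ultimately show ?thesis by (simp add: cyclic_perms_def)
qed

lemma support_admissible:
  assumes \<sigma>: "\<sigma> \<in> r_cycles r d" and E: "respects_edges E \<sigma>"
  shows "{x. \<sigma> x \<noteq> x} \<in> admissible_supports E r d"
proof -
  have p: "\<sigma> permutes {1..d}" using \<sigma> by (simp add: r_cycles_def)
  have "{x. \<sigma> x \<noteq> x} \<subseteq> {1..d}" using p unfolding permutes_def by auto
  moreover have "\<sigma> c = c" if "c \<in> loop_vertices E" for c
    using respects_edgesD[OF E] that by (simp add: loop_vertices_def)
  \<comment> \<open>A colour of the graph without a loop lies on an edge to or from another colour.
    If it were fixed, the edge would be a loop: directly for an outgoing edge, by injectivity for an
    incoming one.\<close>
  moreover have "\<sigma> c \<noteq> c" if c: "c \<in> moved_vertices E" for c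
  proof
    assume fixed: "\<sigma> c = c"
    have "(c, c) \<notin> E" using c by (simp add: moved_vertices_def loop_vertices_def)
    have "c \<in> Field E" using c by (simp add: moved_vertices_def)
    then consider v where "(c, v) \<in> E" | u where "(u, c) \<in> E" by (auto simp: Field_def)
    then show False
    proof cases
      case 1
      then show ?thesis using respects_edgesD[OF E 1] fixed \<open>(c, c) \<notin> E\<close> by simp
    next
      case 2
      then have "\<sigma> u = \<sigma> c" using respects_edgesD[OF E 2] fixed by simp
      then have "u = c" using permutes_inj[OF p] by (simp add: inj_eq)
      then show ?thesis using 2 \<open>(c, c) \<notin> E\<close> by simp
    qed
  qed
  moreover have "card {x. \<sigma> x \<noteq> x} = r" using \<sigma> by (simp add: r_cycles_def)
  ultimately show ?thesis unfolding admissible_supports_def by auto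
qed

lemma cyclic_perms_admissible:
  assumes "2 \<le> r" and X: "X \<in> admissible_supports E r d"
    and \<sigma>: "\<sigma> \<in> cyclic_perms X" "respects_edges (E - Id) \<sigma>"
  shows "\<sigma> \<in> r_cycles r d" "respects_edges E \<sigma>"
proof -
  have Xd: "X \<subseteq> {1..d}" "X \<inter> loop_vertices E = {}" "card X = r"
    using X by (auto simp: admissible_supports_def)
  have p: "\<sigma> permutes X" "cyclic_on \<sigma> X" using \<sigma>(1) by (simp_all add: cyclic_perms_def)
  have "{x. \<sigma> x \<noteq> x} = X" using support_cyclic_perms[OF \<sigma>(1)] assms(1) Xd(3) by simp
  then show "\<sigma> \<in> r_cycles r d"
    using p Xd permutes_subset[OF p(1) Xd(1)] by (simp add: r_cycles_def)
  show "respects_edges E \<sigma>"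
  proof (rule respects_edgesI)
    fix u v assume uv: "(u, v) \<in> E"
    show "\<sigma> u = v"
    proof (cases "u = v")
      case True
      then have "u \<notin> X" using uv Xd(2) by (auto simp: loop_vertices_def)
      then show ?thesis using p(1) True by (simp add: permutes_def)
    next
      case False
      then show ?thesis using uv by (intro respects_edgesD[OF \<sigma>(2)]) simp
    qed
  qed
qed

text \<open>Sort the cycles by support. Loops may be dropped from \<open>E\<close> because
  admissible supports avoid their colours, which are therefore fixed anyway.\<close>

lemma r_cycles_respecting_eq:
  assumes "2 \<le> r"
  shows "{\<sigma> \<in> r_cycles r d. respects_edges E \<sigma>} =
    (\<Union>X\<in>admissible_supports E r d. {\<sigma> \<in> cyclic_perms X. respects_edges (E - Id) \<sigma>})"
proof (intro equalityI subsetI)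
  fix \<sigma> assume "\<sigma> \<in> {\<sigma> \<in> r_cycles r d. respects_edges E \<sigma>}"
  then have \<sigma>: "\<sigma> \<in> r_cycles r d" "respects_edges E \<sigma>" by simp_all
  have "respects_edges (E - Id) \<sigma>" using \<sigma>(2) by (simp add: respects_edges_def)
  then show "\<sigma> \<in> (\<Union>X\<in>admissible_supports E r d. {\<sigma> \<in> cyclic_perms X. respects_edges (E - Id) \<sigma>})"
    using r_cycle_cyclic_perms[OF \<sigma>(1)] support_admissible[OF \<sigma>] by (intro UN_I CollectI conjI)
next
  fix \<sigma> assume "\<sigma> \<in> (\<Union>X\<in>admissible_supports E r d. {\<sigma> \<in> cyclic_perms X. respects_edges (E - Id) \<sigma>})"
  then obtain X where "X \<in> admissible_supports E r d" "\<sigma> \<in> cyclic_perms X" "respects_edges (E - Id) \<sigma>"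
    by auto
  then show "\<sigma> \<in> {\<sigma> \<in> r_cycles r d. respects_edges E \<sigma>}"
    using cyclic_perms_admissible[OF assms] by simp
qed

text \<open>With \<open>a\<close> colours and \<open>b\<close> loop colours in the graph, the
  \<open>a - b\<close> moved colours are forced into the support. What remains is to choose
  \<open>r - (a - b)\<close> of the \<open>d - a\<close> colours outside the graph; the last
  assumption keeps this difference from being truncated.\<close>

lemma card_admissible_supports:
  assumes E: "finite E" "Field E \<subseteq> {1..d}" and "card (Field E) \<le> r + card (loop_vertices E)"
  shows "card (admissible_supports E r d) =
    (d - card (Field E)) choose (r + card (loop_vertices E) - card (Field E))"
proof -
  let ?V = "moved_vertices E" and ?R = "{1..d} - Field E"
  let ?k = "r + card (loop_vertices E) - card (Field E)"
  have fin: "finite (Field E)" using E(1) by (rule finite_Field)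
  have V: "finite ?V" "?V \<subseteq> {1..d} - loop_vertices E" "?R \<inter> ?V = {}" "?R \<union> ?V = {1..d} - loop_vertices E"
    using fin E(2) loop_vertices_subset[of E] by (auto simp: moved_vertices_def)
  have "card (loop_vertices E) \<le> card (Field E)" using fin loop_vertices_subset by (rule card_mono)
  then have k: "r = ?k + card ?V" using assms(3) card_moved_vertices[OF E(1)] by simp
  have "bij_betw (\<lambda>Y. Y \<union> ?V) {Y. Y \<subseteq> ?R \<and> card Y = ?k} (admissible_supports E r d)"
  proof (rule bij_betw_byWitness[where f' = "\<lambda>X. X - ?V"])
    show "\<forall>Y\<in>{Y. Y \<subseteq> ?R \<and> card Y = ?k}. Y \<union> ?V - ?V = Y" using V(3) by auto
    show "\<forall>X\<in>admissible_supports E r d. X - ?V \<union> ?V = X" by (auto simp: admissible_supports_def)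
    show "(\<lambda>Y. Y \<union> ?V) ` {Y. Y \<subseteq> ?R \<and> card Y = ?k} \<subseteq> admissible_supports E r d"
    proof (intro image_subsetI)
      fix Y assume "Y \<in> {Y. Y \<subseteq> ?R \<and> card Y = ?k}"
      then have Y: "Y \<subseteq> ?R" "card Y = ?k" by simp_all
      have "card (Y \<union> ?V) = card Y + card ?V"
        using Y(1) V by (intro card_Un_disjoint) (auto intro: finite_subset)
      then have "card (Y \<union> ?V) = r" using Y(2) k by simp
      moreover have "Y \<union> ?V \<subseteq> {1..d} - loop_vertices E" using Y(1) V(4) by blast
      ultimately show "Y \<union> ?V \<in> admissible_supports E r d" by (simp add: admissible_supports_def)
    qed
    show "(\<lambda>X. X - ?V) ` admissible_supports E r d \<subseteq> {Y. Y \<subseteq> ?R \<and> card Y = ?k}"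
    proof (intro image_subsetI CollectI conjI)
      fix X assume "X \<in> admissible_supports E r d"
      then have X: "?V \<subseteq> X" "X \<subseteq> {1..d} - loop_vertices E" "card X = r"
        by (simp_all add: admissible_supports_def)
      show "X - ?V \<subseteq> ?R" using X(2) V(4) by blast
      have "card (X - ?V) = card X - card ?V" using V(1) X(1) by (rule card_Diff_subset)
      then show "card (X - ?V) = ?k" using X(3) k by simp
    qed
  qed
  then have "card (admissible_supports E r d) = card {Y. Y \<subseteq> ?R \<and> card Y = ?k}"
    by (rule bij_betw_same_card[symmetric])
  also have "\<dots> = card ?R choose ?k" by (rule n_subsets) simp
  also have "card ?R = d - card (Field E)" using card_Diff_subset[OF fin E(2)] by simp
  finally show ?thesis .
qed

text \<open>Of the \<open>c\<close> components of the graph, the \<open>b\<close> loop colours form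
  one each and disappear, while the support adds \<open>r - (a - b)\<close> isolated points. This
  leaves \<open>r + c - a\<close> components on \<open>X\<close>.\<close>

lemma card_admissible_cyclic_perms:
  assumes E: "finite E" and X: "X \<in> admissible_supports E r d"
    and \<sigma>: "\<sigma> \<in> cyclic_perms X" "respects_edges (E - Id) \<sigma>"
    and c: "card (closed_subsets (Field E) E) = 2 ^ c"
  shows "card {\<sigma> \<in> cyclic_perms X. respects_edges (E - Id) \<sigma>} = fact (r + c - card (Field E) - 1)"
proof -
  let ?V = "moved_vertices E" and ?L = "loop_vertices E"
  have fin: "finite (Field E)" using E by (rule finite_Field)
  have X': "?V \<subseteq> X" "X \<subseteq> {1..d} - ?L" "card X = r"
    using X by (simp_all add: admissible_supports_def)
  have finX: "finite X" using X'(2) by (rule finite_subset) simp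
  have p: "\<sigma> permutes X" using \<sigma>(1) by (simp add: cyclic_perms_def)
  \<comment> \<open>By the given \<open>\<sigma>\<close>, both ends of a proper edge are moved and
    so lie in \<open>X\<close>, which avoids the loop colours.\<close>
  have EV: "E - Id \<subseteq> ?V \<times> ?V"
  proof (rule subrelI)
    fix u v assume "(u, v) \<in> E - Id"
    then have uv: "(u, v) \<in> E" "(u, v) \<notin> Id" by simp_all
    then have "\<sigma> u = v" by (intro respects_edgesD[OF \<sigma>(2)]) simp
    then have "u \<in> X" "v \<in> X" using uv(2) p permutes_in_image[OF p, of u] unfolding permutes_def by auto
    moreover have "u \<in> Field E" "v \<in> Field E" using uv(1) by (auto simp: Field_def)
    ultimately show "(u, v) \<in> ?V \<times> ?V" using X'(2) by (auto simp: moved_vertices_def)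
  qed
  have L: "Field E - ?V = ?L" "?V \<subseteq> Field E"
    using loop_vertices_subset[of E] by (auto simp: moved_vertices_def)
  have ab: "card ?L \<le> card (Field E)" using fin loop_vertices_subset by (rule card_mono)
  have r: "card ?V \<le> r" using card_mono[OF finX X'(1)] X'(3) by simp
  have "2 ^ c = 2 ^ card ?L * card (closed_subsets ?V (E - Id))"
    using card_closed_subsets_supset[OF fin L(2) EV] c by (simp add: closed_subsets_Diff_Id L(1))
  then have c': "2 ^ card ?L * card (closed_subsets ?V (E - Id)) = (2::nat) ^ c" by simp
  \<comment> \<open>Divisibility of powers of 2 gives \<open>card ?L \<le> c\<close>, so that the
    exponent \<open>c - card ?L\<close> is a true difference.\<close>
  then have "(2::nat) ^ card ?L dvd 2 ^ c" by (metis dvd_triv_left)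
  then have bc: "card ?L \<le> c" by (rule power_dvd_imp_le) simp
  then have "(2::nat) ^ c = 2 ^ card ?L * 2 ^ (c - card ?L)" by (simp flip: power_add)
  then have cV: "card (closed_subsets ?V (E - Id)) = 2 ^ (c - card ?L)" using c' by simp
  have "card (closed_subsets X (E - Id)) = 2 ^ card (X - ?V) * 2 ^ (c - card ?L)"
    using card_closed_subsets_supset[OF finX X'(1) EV] unfolding cV .
  also have "card (X - ?V) = r - card ?V"
    using card_Diff_subset[OF finite_subset[OF X'(1) finX] X'(1)] X'(3) by simp
  also have "2 ^ (r - card ?V) * 2 ^ (c - card ?L) = (2::nat) ^ (r + c - card (Field E))"
    unfolding power_add[symmetric] using card_moved_vertices[OF E] ab bc r by (intro arg_cong[of _ _ "(^) 2"]) simp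
  finally have "card (closed_subsets X (E - Id)) = 2 ^ (r + c - card (Field E))" .
  moreover have "E - Id \<subseteq> X \<times> X" using EV X'(1) by auto
  ultimately show ?thesis using card_cyclic_perms_respecting[OF finX _ \<sigma>] by simp
qed

text \<open>Supports are counted by a binomial coefficient and the cycles on each by a factorial.
  The assumption \<open>ex\<close> is separate because the sizes alone do not exclude prescriptions
  that no cycle satisfies.\<close>

lemma card_r_cycles_respecting:
  assumes r: "2 \<le> r" and E: "finite E" "Field E \<subseteq> {1..d}"
    and ab: "card (Field E) \<le> r + card (loop_vertices E)"
    and c: "card (closed_subsets (Field E) E) = 2 ^ c"
    and ex: "\<And>X. X \<in> admissible_supports E r d \<Longrightarrow> \<exists>\<sigma>\<in>cyclic_perms X. respects_edges (E - Id) \<sigma>"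
  shows "card {\<sigma> \<in> r_cycles r d. respects_edges E \<sigma>} =
    ((d - card (Field E)) choose (r + card (loop_vertices E) - card (Field E))) *
    fact (r + c - card (Field E) - 1)"
proof -
  let ?C = "\<lambda>X. {\<sigma> \<in> cyclic_perms X. respects_edges (E - Id) \<sigma>}"
  have X: "finite X" "card X = r" if "X \<in> admissible_supports E r d" for X
    using that by (auto simp: admissible_supports_def intro: finite_subset)
  have "finite (admissible_supports E r d)"
    by (rule finite_subset[of _ "Pow {1..d}"]) (auto simp: admissible_supports_def)
  moreover have "finite (?C X)" if "X \<in> admissible_supports E r d" for X
    using finite_cyclic_perms[OF X(1)[OF that]] by simp
  moreover have "?C X \<inter> ?C Y = {}"
    if "X \<in> admissible_supports E r d" "Y \<in> admissible_supports E r d" "X \<noteq> Y" for X Y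
    using that support_cyclic_perms X(2) r by (metis (no_types, lifting) disjoint_iff mem_Collect_eq)
  ultimately have "card (\<Union>X\<in>admissible_supports E r d. ?C X) = (\<Sum>X\<in>admissible_supports E r d. card (?C X))"
    by (intro card_UN_disjoint) auto
  also have "\<dots> = (\<Sum>X\<in>admissible_supports E r d. fact (r + c - card (Field E) - 1))"
  proof (rule sum.cong[OF refl])
    fix X assume A: "X \<in> admissible_supports E r d"
    then obtain \<sigma> where "\<sigma> \<in> cyclic_perms X" "respects_edges (E - Id) \<sigma>" using ex by blast
    then show "card (?C X) = fact (r + c - card (Field E) - 1)"
      by (rule card_admissible_cyclic_perms[OF E(1) A _ _ c])
  qed
  also have "\<dots> = card (admissible_supports E r d) * fact (r + c - card (Field E) - 1)" by simp
  finally show ?thesis unfolding r_cycles_respecting_eq[OF r] card_admissible_supports[OF E ab] .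
qed

text \<open>Conjugating a cycle by a bijection of supports that extends the relabelling \<open>g\<close>.\<close>

lemma cyclic_perms_transport:
  assumes \<sigma>: "\<sigma> \<in> r_cycles r d" "respects_edges E \<sigma>" and E: "finite E"
    and g: "inj_on g (Field E)"
    and Y: "Y \<in> admissible_supports (map_prod g g ` E) r d'"
  shows "\<exists>\<tau>\<in>cyclic_perms Y. respects_edges (map_prod g g ` E - Id) \<tau>"
proof -
  let ?E' = "map_prod g g ` E"
  define X where "X = {x. \<sigma> x \<noteq> x}"
  let ?V = "moved_vertices E"
  have "X \<in> admissible_supports E r d" unfolding X_def using \<sigma> by (rule support_admissible)
  then have X: "?V \<subseteq> X" "card X = r" "finite X"
    by (auto simp: admissible_supports_def intro: finite_subset)
  have "\<sigma> \<in> cyclic_perms X" unfolding X_def using \<sigma>(1) by (rule r_cycle_cyclic_perms)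
  then have p: "\<sigma> permutes X" "cyclic_on \<sigma> X" by (simp_all add: cyclic_perms_def)
  have Y': "moved_vertices ?E' \<subseteq> Y" "card Y = r" "finite Y"
    using Y by (auto simp: admissible_supports_def intro: finite_subset)
  have field: "Field ?E' = g ` Field E" by (force simp: Field_def)
  have loops: "loop_vertices ?E' = g ` loop_vertices E"
  proof (intro equalityI subsetI)
    fix c assume "c \<in> loop_vertices ?E'"
    then obtain u v where uv: "(u, v) \<in> E" "g u = c" "g v = c" by (auto simp: loop_vertices_def)
    have "g u = g v" using uv(2,3) by simp
    then have "u = v" using FieldI1[OF uv(1)] FieldI2[OF uv(1)] by (rule inj_onD[OF g])
    then have "u \<in> loop_vertices E" using uv(1) by (simp add: loop_vertices_def)
    then show "c \<in> g ` loop_vertices E" using uv(2) by (rule rev_image_eqI[OF _ sym])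
  qed (force simp: loop_vertices_def)
  have moved: "moved_vertices ?E' = g ` ?V"
    unfolding moved_vertices_def field loops using loop_vertices_subset[of E]
    by (intro inj_on_image_set_diff[symmetric, OF g]) auto
  have injV: "inj_on g ?V" using g by (rule inj_on_subset) (auto simp: moved_vertices_def)
  \<comment> \<open>Both supports have \<open>r\<close> elements and \<open>g\<close> matches the
    moved colours inside them, so the remaining points of \<open>X\<close> and \<open>Y\<close> can
    be matched by any bijection.\<close>
  have "card (X - ?V) = card (Y - g ` ?V)"
    using X Y' card_image[OF injV] unfolding moved
    by (simp add: card_Diff_subset finite_subset)
  then obtain h0 where h0: "bij_betw h0 (X - ?V) (Y - g ` ?V)"
    using X(3) Y'(3) by (metis finite_Diff finite_same_card_bij)
  define h where "h x = (if x \<in> ?V then g x else h0 x)" for x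
  have "bij_betw h ?V (g ` ?V)"
    using inj_on_imp_bij_betw[OF injV] by (subst bij_betw_cong[of _ h g]) (auto simp: h_def)
  moreover have "bij_betw h (X - ?V) (Y - g ` ?V)"
    using h0 by (subst bij_betw_cong[of _ h h0]) (auto simp: h_def)
  ultimately have "bij_betw h (?V \<union> (X - ?V)) (g ` ?V \<union> (Y - g ` ?V))"
    by (rule bij_betw_combine) auto
  then have h: "bij_betw h X Y" using X(1) Y'(1) unfolding moved by (simp add: Un_absorb1)
  define \<tau> where "\<tau> = (\<lambda>y. if y \<in> Y then h (\<sigma> (inv_into X h y)) else y)"
  have "\<tau> permutes Y" unfolding \<tau>_def using p(1) h by (rule permutes_bij_inv_into)
  moreover have \<tau>h: "\<tau> (h x) = h (\<sigma> x)" if "x \<in> X" for x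
    using that h by (auto simp: \<tau>_def bij_betw_def inv_into_f_f)
  have "cyclic_on \<tau> (h ` X)" using p(2) \<tau>h by (rule cyclic_on_image)
  then have "cyclic_on \<tau> Y" using h by (simp add: bij_betw_def)
  ultimately have "\<tau> \<in> cyclic_perms Y" by (simp add: cyclic_perms_def)
  moreover have "respects_edges (?E' - Id) \<tau>"
  proof (rule respects_edgesI)
    fix a b assume "(a, b) \<in> ?E' - Id"
    then obtain u v where uv: "(u, v) \<in> E" "a = g u" "b = g v" "u \<noteq> v" by auto
    have \<sigma>uv: "\<sigma> u = v" using \<sigma>(2) uv(1) by (rule respects_edgesD)
    have notloop: "u \<notin> loop_vertices E" "v \<notin> loop_vertices E"
    proof -
      show "u \<notin> loop_vertices E"
        using respects_edgesD[OF \<sigma>(2), of u u] \<sigma>uv uv(4) by (auto simp: loop_vertices_def)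
      have "\<sigma> v \<noteq> v" using \<sigma>uv uv(4) permutes_inj[OF p(1)] by (metis injD)
      then show "v \<notin> loop_vertices E"
        using respects_edgesD[OF \<sigma>(2), of v v] by (auto simp: loop_vertices_def)
    qed
    have "u \<in> Field E" "v \<in> Field E" using uv(1) by (auto simp: Field_def)
    then have V: "u \<in> ?V" "v \<in> ?V" using notloop by (simp_all add: moved_vertices_def)
    have "\<tau> (h u) = h v" using \<tau>h[of u] X(1) V(1) \<sigma>uv by auto
    then show "\<tau> a = b" using V uv(2,3) by (simp add: h_def)
  qed
  ultimately show ?thesis by blast
qed

section \<open>The graph of a colouring and the numbers a, b, c\<close>

definition edges :: "nat \<Rightarrow> (nat \<Rightarrow> nat) \<Rightarrow> (nat \<Rightarrow> nat) \<Rightarrow> (nat \<times> nat) set" where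
  "edges n i k = (\<lambda>j. (i j, k j)) ` {1..n}"

lemma finite_edges: "finite (edges n i k)"
  by (simp add: edges_def)

lemma respects_edges_iff: "respects_edges (edges n i k) \<sigma> \<longleftrightarrow> (\<forall>j\<in>{1..n}. \<sigma> (i j) = k j)"
  by (simp add: respects_edges_def edges_def)

lemma Field_edges: "Field (edges n i k) = color i k ` vertices n n"
proof -
  have "Domain (edges n i k) = i ` {1..n}" "Range (edges n i k) = k ` {1..n}"
    unfolding edges_def Domain_fst Range_snd image_image by simp_all
  then show ?thesis by (simp add: Field_def vertices_def image_Un image_image)
qed

lemma Field_edges_subset:
  assumes "i \<in> index_functions n d" "k \<in> index_functions n d"
  shows "Field (edges n i k) \<subseteq> {1..d}"
proof -
  have "color i k v \<in> {1..d}" if "v \<in> vertices n n" for v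
    using assms that unfolding vertices_def index_functions_def by (auto dest: PiE_mem)
  then show ?thesis unfolding Field_edges by (rule image_subsetI)
qed

lemma card_Field_edges: "card (Field (edges n i k)) \<le> 2 * n"
proof -
  have "card (Field (edges n i k)) \<le> card (vertices n n)"
    unfolding Field_edges by (rule card_image_le[OF finite_vertices])
  also have "\<dots> \<le> card (Unprimed ` {1..n}) + card (Primed ` {1..n})"
    unfolding vertices_def by (rule card_Un_le)
  also have "\<dots> \<le> n + n"
    using card_image_le[of "{1..n}" Unprimed] card_image_le[of "{1..n}" Primed] by simp
  finally show ?thesis by simp
qed

lemma inj_on_color_class: "inj_on (\<lambda>c. {v \<in> V. h v = c}) (h ` V)"
proof (rule inj_onI)
  fix b c assume "b \<in> h ` V" and eq: "{v \<in> V. h v = b} = {v \<in> V. h v = c}"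
  then obtain v where v: "v \<in> V" "h v = b" by auto
  then have "v \<in> {v \<in> V. h v = c}" unfolding eq[symmetric] by simp
  then show "b = c" using v(2) by simp
qed

lemma num_parts_kernel: "num_parts (kernel n n i k) = card (Field (edges n i k))"
  unfolding num_parts_def kernel_def Field_edges by (rule card_image[OF inj_on_color_class])

lemma num_fixed_parts_kernel:
  "num_fixed_parts n (kernel n n i k) = card (loop_vertices (edges n i k))"
proof -
  let ?cls = "\<lambda>c. {v \<in> vertices n n. color i k v = c}"
  let ?L = "loop_vertices (edges n i k)"
  have L: "c \<in> ?L \<longleftrightarrow> (\<exists>j\<in>{1..n}. i j = c \<and> k j = c)" for c
    unfolding loop_vertices_def edges_def by auto
  have LF: "?L \<subseteq> color i k ` vertices n n"
    using loop_vertices_subset[of "edges n i k"] unfolding Field_edges .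
  have mem: "Unprimed j \<in> vertices n n" "Primed j \<in> vertices n n" if "j \<in> {1..n}" for j
    using that by (auto simp: vertices_def)
  have "{B \<in> kernel n n i k. \<exists>j\<in>{1..n}. Unprimed j \<in> B \<and> Primed j \<in> B} = ?cls ` ?L"
  proof (intro equalityI subsetI)
    fix B assume "B \<in> {B \<in> kernel n n i k. \<exists>j\<in>{1..n}. Unprimed j \<in> B \<and> Primed j \<in> B}"
    then obtain j c where j: "j \<in> {1..n}" "Unprimed j \<in> B" "Primed j \<in> B" and B: "B = ?cls c"
      unfolding kernel_def by auto
    have "i j = c" "k j = c" using j B by simp_all
    then have "c \<in> ?L" using L j(1) by auto
    then show "B \<in> ?cls ` ?L" unfolding B by (rule imageI)
  next
    fix B assume "B \<in> ?cls ` ?L"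
    then obtain c where c: "c \<in> ?L" "B = ?cls c" by auto
    then obtain j where j: "j \<in> {1..n}" "i j = c" "k j = c" using L by auto
    have "B \<in> kernel n n i k" unfolding kernel_def c(2) using LF c(1) by (intro imageI) auto
    moreover have "Unprimed j \<in> B" "Primed j \<in> B" using j mem[OF j(1)] c(2) by simp_all
    ultimately show "B \<in> {B \<in> kernel n n i k. \<exists>j\<in>{1..n}. Unprimed j \<in> B \<and> Primed j \<in> B}"
      using j(1) by auto
  qed
  then show ?thesis
    unfolding num_fixed_parts_def using card_image[OF inj_on_subset[OF inj_on_color_class LF]] by simp
qed

text \<open>Preimages under the colouring turn closed sets of colours into unions of colour classes
  that contain \<open>Unprimed j\<close> and \<open>Primed j\<close> together or not at all. Hence
  the graph on the colours has as many components as the joined diagram.\<close>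

lemma card_closed_subsets_edges:
  "card (closed_subsets (Field (edges n i k)) (edges n i k)) =
    2 ^ num_joined_components n (kernel n n i k)"
proof -
  let ?V = "vertices n n" and ?F = "color i k ` vertices n n"
  let ?J = "(\<lambda>j. {Unprimed j, Primed j}) ` {1..n}"
  let ?\<E> = "kernel n n i k \<union> ?J"
  let ?T = "{A. A \<subseteq> \<Union>?\<E> \<and> part_constant ?\<E> (\<lambda>x. x \<in> A)}"
  have mem: "Unprimed j \<in> ?V" "Primed j \<in> ?V" if "j \<in> {1..n}" for j
    using that by (auto simp: vertices_def)
  have un: "\<Union>?\<E> = ?V"
    using Union_P[OF kernel_in_P, of n n i k] mem by auto
  have join: "part_constant ?J (\<lambda>x. x \<in> A) \<longleftrightarrow> (\<forall>j\<in>{1..n}. Unprimed j \<in> A \<longleftrightarrow> Primed j \<in> A)" for A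
    unfolding part_constant_def by auto
  have closed: "A \<in> closed_subsets ?F (edges n i k) \<longleftrightarrow>
      A \<subseteq> ?F \<and> (\<forall>j\<in>{1..n}. i j \<in> A \<longleftrightarrow> k j \<in> A)" for A
    unfolding closed_subsets_def edges_def by auto
  have same: "x \<in> A \<longleftrightarrow> y \<in> A"
    if "part_constant (kernel n n i k) (\<lambda>x. x \<in> A)" "x \<in> ?V" "y \<in> ?V" "color i k x = color i k y" for A x y
  proof -
    have "\<exists>B\<in>kernel n n i k. x \<in> B \<and> y \<in> B" using that(2-4) by (simp add: in_same_kernel_part)
    then show ?thesis using that(1) unfolding part_constant_def by auto
  qed
  have "bij_betw (\<lambda>A. {v \<in> ?V. color i k v \<in> A}) (closed_subsets ?F (edges n i k)) ?T"
  proof (rule bij_betw_byWitness[where f' = "\<lambda>A. color i k ` A"])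
    show "\<forall>A\<in>closed_subsets ?F (edges n i k). color i k ` {v \<in> ?V. color i k v \<in> A} = A"
    proof
      fix A assume "A \<in> closed_subsets ?F (edges n i k)"
      then have "A \<subseteq> ?F" by (simp add: closed)
      then show "color i k ` {v \<in> ?V. color i k v \<in> A} = A" by auto
    qed
    show "\<forall>A\<in>?T. {v \<in> ?V. color i k v \<in> color i k ` A} = A"
    proof
      fix A assume "A \<in> ?T"
      then have A: "A \<subseteq> ?V" "part_constant (kernel n n i k) (\<lambda>x. x \<in> A)"
        by (simp_all only: mem_Collect_eq un part_constant_Un)
      show "{v \<in> ?V. color i k v \<in> color i k ` A} = A"
      proof (intro equalityI subsetI)
        fix v assume "v \<in> {v \<in> ?V. color i k v \<in> color i k ` A}"
        then obtain w where "v \<in> ?V" "w \<in> A" "color i k v = color i k w" by auto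
        then show "v \<in> A" using same[OF A(2), of v w] A(1) by auto
      qed (use A(1) in auto)
    qed
    show "(\<lambda>A. {v \<in> ?V. color i k v \<in> A}) ` closed_subsets ?F (edges n i k) \<subseteq> ?T"
    proof (intro image_subsetI CollectI conjI)
      fix A assume A: "A \<in> closed_subsets ?F (edges n i k)"
      show "{v \<in> ?V. color i k v \<in> A} \<subseteq> \<Union>?\<E>" unfolding un by auto
      have "part_constant (kernel n n i k) (\<lambda>x. x \<in> {v \<in> ?V. color i k v \<in> A})"
        unfolding part_constant_def kernel_def by auto
      moreover have "part_constant ?J (\<lambda>x. x \<in> {v \<in> ?V. color i k v \<in> A})"
        unfolding join using A mem by (simp add: closed)
      ultimately show "part_constant ?\<E> (\<lambda>x. x \<in> {v \<in> ?V. color i k v \<in> A})"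
        by (simp add: part_constant_Un)
    qed
    show "(`) (color i k) ` ?T \<subseteq> closed_subsets ?F (edges n i k)"
    proof (intro image_subsetI)
      fix A assume "A \<in> ?T"
      then have A: "A \<subseteq> ?V" "part_constant (kernel n n i k) (\<lambda>x. x \<in> A)" "part_constant ?J (\<lambda>x. x \<in> A)"
        by (simp_all only: mem_Collect_eq un part_constant_Un)
      have img: "color i k x \<in> color i k ` A \<longleftrightarrow> x \<in> A" if x: "x \<in> ?V" for x
      proof
        assume "color i k x \<in> color i k ` A"
        then obtain y where "y \<in> A" "color i k x = color i k y" by auto
        then show "x \<in> A" using same[OF A(2) x, of y] A(1) by auto
      qed auto
      have "i j \<in> color i k ` A \<longleftrightarrow> k j \<in> color i k ` A" if j: "j \<in> {1..n}" for j
        using img[OF mem(1)[OF j]] img[OF mem(2)[OF j]] A(3) j unfolding join by simp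
      moreover have "color i k ` A \<subseteq> ?F" using A(1) by (rule image_mono)
      ultimately show "color i k ` A \<in> closed_subsets ?F (edges n i k)" unfolding closed by simp
    qed
  qed
  then have "card (closed_subsets ?F (edges n i k)) = card ?T" by (rule bij_betw_same_card)
  also have "\<dots> = 2 ^ card (components_of ?\<E>)"
    by (rule card_components_of) (simp only: un finite_vertices)
  finally show ?thesis unfolding Field_edges num_joined_components_def .
qed

text \<open>Colourings with the same colour classes differ by a renaming of colours, which is well
  defined and injective because the classes agree in both directions.\<close>

lemma edges_relabel:
  assumes "kernel n n i k = kernel n n i' k'"
  obtains g where "inj_on g (Field (edges n i k))" "edges n i' k' = map_prod g g ` edges n i k"
proof -
  let ?V = "vertices n n"
  have same: "color i k x = color i k y \<longleftrightarrow> color i' k' x = color i' k' y" if "x \<in> ?V" "y \<in> ?V" for x y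
    using in_same_kernel_part[of n n i k x y] in_same_kernel_part[of n n i' k' x y] that
    unfolding assms by simp
  define rep where "rep c = (SOME v. v \<in> ?V \<and> color i k v = c)" for c
  have rep: "rep (color i k v) \<in> ?V" "color i k (rep (color i k v)) = color i k v" if "v \<in> ?V" for v
    using someI[of "\<lambda>w. w \<in> ?V \<and> color i k w = color i k v" v] that unfolding rep_def by simp_all
  define g where "g c = color i' k' (rep c)" for c
  have g: "g (color i k v) = color i' k' v" if "v \<in> ?V" for v
    unfolding g_def using same[OF rep(1)[OF that] that] rep(2)[OF that] by simp
  have "inj_on g (Field (edges n i k))"
    unfolding Field_edges
  proof (rule inj_onI)
    fix b c assume "b \<in> color i k ` ?V" "c \<in> color i k ` ?V" and eq: "g b = g c"
    then obtain x y where xy: "x \<in> ?V" "y \<in> ?V" "b = color i k x" "c = color i k y" by auto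
    then have "color i' k' x = color i' k' y" using eq g by simp
    then show "b = c" using same[OF xy(1,2)] xy(3,4) by simp
  qed
  moreover have "edges n i' k' = map_prod g g ` edges n i k"
  proof -
    have "g (i j) = i' j" "g (k j) = k' j" if "j \<in> {1..n}" for j
      using g[of "Unprimed j"] g[of "Primed j"] that by (auto simp: vertices_def)
    then show ?thesis unfolding edges_def image_image by (intro image_cong) simp_all
  qed
  ultimately show ?thesis by (rule that)
qed

section \<open>The coefficients q as numbers of cycles\<close>

lemma r_cycles_one: "r_cycles 1 d = {}"
proof -
  have False if \<sigma>: "\<sigma> \<in> r_cycles 1 d" for \<sigma>
  proof -
    obtain x where x: "{x. \<sigma> x \<noteq> x} = {x}"
      using \<sigma> card_1_singletonE[of "{x. \<sigma> x \<noteq> x}"] unfolding r_cycles_def by auto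
    then have "cyclic_on \<sigma> {x}" using \<sigma> unfolding r_cycles_def by simp
    then have "\<sigma> x \<in> {x}" by (rule cyclic_on_inI) simp
    moreover have "\<sigma> x \<noteq> x" using x by auto
    ultimately show False by simp
  qed
  then show ?thesis by auto
qed

lemma finite_r_cycles: "finite (r_cycles r d)"
  by (rule finite_subset[OF _ finite_permutations[of "{1..d}"]]) (auto simp: r_cycles_def)

lemma perfect_pairs_kernel:
  "perfect_pairs n (kernel n n i k) d =
    {(i', k'). i' \<in> index_functions n d \<and> k' \<in> index_functions n d \<and> kernel n n i' k' = kernel n n i k}"
  unfolding perfect_pairs_def perfect_coloring_iff_kernel[OF kernel_in_P] by auto

text \<open>\<open>S\<close> evaluates at a perfect colouring picked by \<open>SOME\<close>. All
  that is known about this colouring is its kernel, which is enough to relabel its graph into the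
  given one.\<close>

lemma S_kernel_obtain:
  assumes "S_defined n (kernel n n i k) r d"
  obtains i' k' where "i' \<in> index_functions n d" "k' \<in> index_functions n d"
    "kernel n n i' k' = kernel n n i k"
    "S n (kernel n n i k) r d = card {\<sigma> \<in> r_cycles r d. respects_edges (edges n i' k') \<sigma>}"
proof -
  let ?p = "SOME p. p \<in> perfect_pairs n (kernel n n i k) d"
  have "?p \<in> perfect_pairs n (kernel n n i k) d"
    using assms unfolding S_defined_def some_in_eq by (elim conjE)
  moreover obtain i' k' where p: "?p = (i', k')" by (rule prod.exhaust)
  ultimately have "i' \<in> index_functions n d" "k' \<in> index_functions n d" "kernel n n i' k' = kernel n n i k"
    unfolding perfect_pairs_kernel by simp_all
  moreover have "S n (kernel n n i k) r d = card {\<sigma> \<in> r_cycles r d. respects_edges (edges n i' k') \<sigma>}"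
    unfolding S_def p Let_def respects_edges_iff by simp
  ultimately show ?thesis by (rule that)
qed

text \<open>The factor for \<open>k = r + b - a\<close> is \<open>d - a\<close>, so read backwards
  the product is the falling factorial of \<open>d - a\<close> of length
  \<open>r + b - a\<close>.\<close>

lemma prod_shift_eq_choose:
  assumes "a \<le> d" "b \<le> a" "a \<le> r + b"
  shows "(\<Prod>k=1..r + b - a. of_nat d - of_nat r - of_nat b + of_nat k :: 'a::field_char_0) =
    fact (r + b - a) * of_nat ((d - a) choose (r + b - a))"
proof -
  let ?m = "r + b - a"
  have "(\<Prod>k=1..?m. of_nat d - of_nat r - of_nat b + of_nat k :: 'a) = (\<Prod>j<?m. of_nat (d - a) - of_nat j)"
  proof (rule prod.reindex_bij_witness[of _ "\<lambda>j. ?m - j" "\<lambda>k. ?m - k"])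
    fix k assume k: "k \<in> {1..?m}"
    have "of_nat (?m - k) = (of_nat r + of_nat b - of_nat a - of_nat k :: 'a)"
    proof -
      have "?m - k + (a + k) = r + b" using k assms(3) unfolding atLeastAtMost_iff by arith
      from arg_cong[OF this, of "of_nat :: nat \<Rightarrow> 'a"] show ?thesis by (simp add: algebra_simps)
    qed
    moreover have "of_nat (d - a) = (of_nat d - of_nat a :: 'a)" using assms(1) by (rule of_nat_diff)
    ultimately show "of_nat (d - a) - of_nat (?m - k) = (of_nat d - of_nat r - of_nat b + of_nat k :: 'a)"
      by simp
  qed auto
  also have "\<dots> = fact ?m * (of_nat (d - a) gchoose ?m)"
    unfolding gbinomial_prod_rev by (simp add: atLeast0LessThan)
  also have "\<dots> = fact ?m * of_nat ((d - a) choose ?m)" by (simp add: binomial_gbinomial)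
  finally show ?thesis .
qed

lemma q_coeff_kernel:
  assumes i: "i \<in> index_functions n d" and k: "k \<in> index_functions n d"
    and r: "0 < r" and d: "2 * n + r \<le> d"
  shows "q_coeff n (kernel n n i k) r (of_nat d) =
    (of_nat (card {\<sigma> \<in> r_cycles r d. respects_edges (edges n i k) \<sigma>}) :: 'a::field_char_0)"
proof (cases "r = 1")
  case True
  \<comment> \<open>Without 1-cycles every \<open>S\<close> is zero, so \<open>q\<close> takes its
    zero branch.\<close>
  have "S n (kernel n n i k) r d' = 0" if "S_defined n (kernel n n i k) r d'" for d'
    using S_kernel_obtain[OF that] unfolding True r_cycles_one by simp
  then show ?thesis unfolding q_coeff_def Let_def by (simp add: True r_cycles_one[simplified])
next
  case False
  then have r2: "2 \<le> r" using r by simp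
  define \<pi> where "\<pi> = kernel n n i k"
  let ?E = "edges n i k"
  define a b c where "a = card (Field ?E)" and "b = card (loop_vertices ?E)"
    and "c = num_joined_components n \<pi>"
  have abc: "num_parts \<pi> = a" "num_fixed_parts n \<pi> = b" "num_joined_components n \<pi> = c"
    unfolding \<pi>_def a_def b_def c_def num_parts_kernel num_fixed_parts_kernel by simp_all
  have a2n: "a \<le> 2 * n" unfolding a_def by (rule card_Field_edges)
  have ba: "b \<le> a"
    unfolding a_def b_def using finite_Field[OF finite_edges] loop_vertices_subset by (rule card_mono)
  show ?thesis
  proof (cases "\<forall>d'>1. S_defined n \<pi> r d' \<longrightarrow> S n \<pi> r d' = 0")
    case True
    have def: "S_defined n \<pi> r d"
      unfolding S_defined_def \<pi>_def perfect_pairs_kernel using i k r d by auto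
    then have S0: "S n \<pi> r d = 0" using True r2 d by simp
    obtain i' k' where ik': "i' \<in> index_functions n d" "k' \<in> index_functions n d"
        "kernel n n i k = kernel n n i' k'"
        "S n \<pi> r d = card {\<sigma> \<in> r_cycles r d. respects_edges (edges n i' k') \<sigma>}"
      using S_kernel_obtain[OF def[unfolded \<pi>_def]] unfolding \<pi>_def by metis
    let ?E' = "edges n i' k'"
    have none: "\<not> (\<sigma> \<in> r_cycles r d \<and> respects_edges ?E' \<sigma>)" for \<sigma>
      using S0 ik'(4) finite_r_cycles[of r d] by auto
    \<comment> \<open>So far cycles are excluded only for the chosen colouring
      \<open>(i', k')\<close>. A cycle for \<open>(i, k)\<close> would be transported to one for
      \<open>(i', k')\<close> on any admissible support, and one such support is built here.\<close>
    have "\<not> (\<sigma> \<in> r_cycles r d \<and> respects_edges ?E \<sigma>)" for \<sigma>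
    proof
      assume \<sigma>: "\<sigma> \<in> r_cycles r d \<and> respects_edges ?E \<sigma>"
      obtain g where g: "inj_on g (Field ?E)" "?E' = map_prod g g ` ?E"
        using edges_relabel[OF ik'(3)] by metis
      have "{x. \<sigma> x \<noteq> x} \<in> admissible_supports ?E r d" using \<sigma> by (intro support_admissible) simp_all
      then have "moved_vertices ?E \<subseteq> {x. \<sigma> x \<noteq> x}" "card {x. \<sigma> x \<noteq> x} = r" "finite {x. \<sigma> x \<noteq> x}"
        by (auto simp: admissible_supports_def intro: finite_subset)
      then have mr: "card (moved_vertices ?E) \<le> r" by (metis card_mono)
      have eq: "card (Field ?E') = a" "card (loop_vertices ?E') = b"
        using num_parts_kernel[of n i' k'] num_fixed_parts_kernel[of n i' k'] abc
        unfolding \<pi>_def ik'(3) by simp_all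
      have F': "Field ?E' \<subseteq> {1..d}" using ik'(1,2) by (rule Field_edges_subset)
      have "card (moved_vertices ?E') \<le> r"
        using mr unfolding card_moved_vertices[OF finite_edges] eq a_def b_def .
      \<comment> \<open>At most \<open>2 * n\<close> colours carry loops, so
        \<open>d \<ge> 2 * n + r\<close> leaves room for a support of size \<open>r\<close>.\<close>
      moreover have "r \<le> card ({1..d} - loop_vertices ?E')"
      proof -
        have "loop_vertices ?E' \<subseteq> {1..d}" using loop_vertices_subset F' by (rule subset_trans)
        then have "card ({1..d} - loop_vertices ?E') = d - b"
          using eq(2) by (subst card_Diff_subset) (auto intro: finite_subset)
        then show ?thesis using a2n ba d by simp
      qed
      moreover have "moved_vertices ?E' \<subseteq> {1..d} - loop_vertices ?E'"
        using F' by (auto simp: moved_vertices_def)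
      ultimately obtain Y where "moved_vertices ?E' \<subseteq> Y" "Y \<subseteq> {1..d} - loop_vertices ?E'" "card Y = r"
        using exists_subset_between[of "moved_vertices ?E'" r "{1..d} - loop_vertices ?E'"] by auto
      then have Y: "Y \<in> admissible_supports ?E' r d" by (simp add: admissible_supports_def)
      then obtain \<tau> where "\<tau> \<in> cyclic_perms Y" "respects_edges (?E' - Id) \<tau>"
        using cyclic_perms_transport[OF _ _ finite_edges g(1)] \<sigma> unfolding g(2) by metis
      then show False using none cyclic_perms_admissible[OF r2 Y] by metis
    qed
    then have "card {\<sigma> \<in> r_cycles r d. respects_edges ?E \<sigma>} = 0" by (metis (no_types, lifting) Collect_empty_eq card.empty)
    moreover have "q_coeff n \<pi> r (of_nat d) = (0 :: 'a)"
      unfolding q_coeff_def Let_def using True by (rule if_P)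
    ultimately show ?thesis unfolding \<pi>_def by simp
  next
    case False
    \<comment> \<open>The witness may live over any number \<open>d'\<close> of colours, smaller or
      larger than \<open>d\<close>. It yields \<open>a \<le> r + b\<close>, and transport places a
      cycle on every admissible support over \<open>d\<close>.\<close>
    then obtain d' where d': "S_defined n \<pi> r d'" "S n \<pi> r d' \<noteq> 0" by auto
    obtain i' k' where ik': "i' \<in> index_functions n d'" "k' \<in> index_functions n d'"
        "kernel n n i' k' = kernel n n i k"
        "S n \<pi> r d' = card {\<sigma> \<in> r_cycles r d'. respects_edges (edges n i' k') \<sigma>}"
      using S_kernel_obtain[OF d'(1)[unfolded \<pi>_def]] unfolding \<pi>_def by metis
    let ?E' = "edges n i' k'"
    have "{\<sigma> \<in> r_cycles r d'. respects_edges ?E' \<sigma>} \<noteq> {}" using d'(2) ik'(4) by force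
    then obtain \<sigma> where \<sigma>: "\<sigma> \<in> r_cycles r d'" "respects_edges ?E' \<sigma>" by auto
    obtain g where g: "inj_on g (Field ?E')" "?E = map_prod g g ` ?E'"
      using edges_relabel[OF ik'(3)] by metis
    have eq: "card (Field ?E') = a" "card (loop_vertices ?E') = b"
      using num_parts_kernel[of n i' k'] num_fixed_parts_kernel[of n i' k'] abc
      unfolding \<pi>_def ik'(3) by simp_all
    have "{x. \<sigma> x \<noteq> x} \<in> admissible_supports ?E' r d'" using \<sigma> by (rule support_admissible)
    then have "moved_vertices ?E' \<subseteq> {x. \<sigma> x \<noteq> x}" "card {x. \<sigma> x \<noteq> x} = r" "finite {x. \<sigma> x \<noteq> x}"
      by (auto simp: admissible_supports_def intro: finite_subset)
    then have "card (moved_vertices ?E') \<le> r" by (metis card_mono)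
    then have arb: "a \<le> r + b" unfolding card_moved_vertices[OF finite_edges] eq by simp
    have "card {\<sigma> \<in> r_cycles r d. respects_edges ?E \<sigma>} =
        ((d - card (Field ?E)) choose (r + card (loop_vertices ?E) - card (Field ?E))) *
        fact (r + c - card (Field ?E) - 1)"
    proof (rule card_r_cycles_respecting[OF r2 finite_edges Field_edges_subset[OF i k]])
      show "card (Field ?E) \<le> r + card (loop_vertices ?E)" using arb unfolding a_def b_def .
      show "card (closed_subsets (Field ?E) ?E) = 2 ^ c"
        unfolding c_def \<pi>_def by (rule card_closed_subsets_edges)
      show "\<exists>\<tau>\<in>cyclic_perms X. respects_edges (?E - Id) \<tau>" if "X \<in> admissible_supports ?E r d" for X
        using cyclic_perms_transport[OF \<sigma> finite_edges g(1)] that unfolding g(2) .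
    qed
    then have count: "card {\<sigma> \<in> r_cycles r d. respects_edges ?E \<sigma>} =
        ((d - a) choose (r + b - a)) * fact (r + c - a - 1)"
      unfolding a_def b_def .
    have "q_coeff n \<pi> r (of_nat d) = (fact (r + c - a - 1) / fact (r + b - a) *
        (\<Prod>k=1..r + b - a. of_nat d - of_nat r - of_nat b + of_nat k) :: 'a)"
      unfolding q_coeff_def Let_def abc using False by (rule if_not_P)
    also have "\<dots> = fact (r + c - a - 1) * of_nat ((d - a) choose (r + b - a))"
      using prod_shift_eq_choose[of a d b r, where 'a = 'a] a2n d ba arb by simp
    finally show ?thesis unfolding \<pi>_def count by simp
  qed
qed

section \<open>Naturality\<close>

lemma compose_in_index_functions:
  assumes "\<sigma> permutes {1..d}" "i \<in> index_functions n d"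
  shows "compose {1..n} \<sigma> i \<in> index_functions n d"
  using assms permutes_in_image[OF assms(1)]
  by (auto simp: index_functions_def compose_def)

lemma compose_eq_iff_respects_edges:
  assumes "k \<in> index_functions n d"
  shows "compose {1..n} \<sigma> i = k \<longleftrightarrow> respects_edges (edges n i k) \<sigma>"
proof
  assume "compose {1..n} \<sigma> i = k"
  then show "respects_edges (edges n i k) \<sigma>"
    unfolding respects_edges_iff by (auto simp: compose_def)
next
  assume *: "respects_edges (edges n i k) \<sigma>"
  show "compose {1..n} \<sigma> i = k"
  proof (rule extensionalityI[of _ "{1..n}"])
    show "k \<in> extensional {1..n}" using assms by (auto simp: index_functions_def PiE_def)
    show "compose {1..n} \<sigma> i j = k j" if "j \<in> {1..n}" for j
      using * that unfolding respects_edges_iff compose_def by simp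
  qed simp
qed

text \<open>The \<open>(i, k)\<close> entry of the matrix by which \<open>Omega r d\<close> acts on
  the tensor power.\<close>

definition cycle_coeff :: "nat \<Rightarrow> nat \<Rightarrow> nat \<Rightarrow> (nat \<Rightarrow> nat) \<Rightarrow> (nat \<Rightarrow> nat) \<Rightarrow> 'a::field_char_0" where
  "cycle_coeff n r d i k = (\<Sum>\<sigma>\<in>r_cycles r d. if compose {1..n} \<sigma> i = k then 1 else 0)"

lemma matrix_coeff_omega_eq_cycle_coeff:
  assumes "i \<in> index_functions n d" "k \<in> index_functions n d" "0 < r" "2 * n + r \<le> d"
  shows "matrix_coeff n n (omega n r (of_nat d)) i k = (cycle_coeff n r d i k :: 'a::field_char_0)"
  unfolding matrix_coeff_omega q_coeff_kernel[OF assms] cycle_coeff_def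
    compose_eq_iff_respects_edges[OF assms(2)]
  using finite_r_cycles[of r d] by (simp flip: sum.inter_filter)

lemma r_cycles_permutes: "\<sigma> \<in> r_cycles r d \<Longrightarrow> \<sigma> permutes {1..d}"
  by (simp add: r_cycles_def)

lemma action_Omega:
  "action n d (Omega r d) w k = (\<Sum>i\<in>index_functions n d. w i * cycle_coeff n r d i k)"
proof -
  have Omega: "Omega r d \<sigma> = (if \<sigma> \<in> r_cycles r d then 1 else 0 :: 'a)" for \<sigma>
    using finite_r_cycles[of r d] unfolding Omega_def basis_vec_def by simp
  have sub: "{\<sigma> \<in> {\<sigma>. \<sigma> permutes {1..d}}. \<sigma> \<in> r_cycles r d} = r_cycles r d"
    using r_cycles_permutes by blast
  have "action n d (Omega r d) w k = (\<Sum>\<sigma>\<in>{\<sigma>. \<sigma> permutes {1..d}}. if \<sigma> \<in> r_cycles r d then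
      \<Sum>i\<in>index_functions n d. w i * (if compose {1..n} \<sigma> i = k then 1 else 0) else 0)"
    unfolding action_def Omega basis_vec_def by (intro sum.cong refl) (simp add: eq_commute[of k])
  also have "\<dots> = (\<Sum>\<sigma>\<in>r_cycles r d. \<Sum>i\<in>index_functions n d.
      w i * (if compose {1..n} \<sigma> i = k then 1 else 0))"
    using finite_permutations[of "{1..d}"] by (simp only: sum.inter_filter[symmetric] sub finite_atLeastAtMost)
  also have "\<dots> = (\<Sum>i\<in>index_functions n d. w i * cycle_coeff n r d i k)"
    unfolding cycle_coeff_def sum_distrib_left by (rule sum.swap)
  finally show ?thesis .
qed

lemma f_map_omega:
  fixes w :: "(nat \<Rightarrow> nat) \<Rightarrow> 'a::field_char_0"
  assumes "0 < r" "2 * n + r \<le> d"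
  shows "f_map n n d (omega n r (of_nat d)) w = action n d (Omega r d) w"
proof
  fix k
  show "f_map n n d (omega n r (of_nat d)) w k = action n d (Omega r d) w k"
  proof (cases "k \<in> index_functions n d")
    case True
    then show ?thesis
      unfolding f_map_eq_matrix_coeff action_Omega
      using matrix_coeff_omega_eq_cycle_coeff[OF _ True assms, where 'a = 'a] by (simp cong: sum.cong)
  next
    case False
    \<comment> \<open>Off the basis, \<open>f_map\<close> yields zero; the action does so too
      because permuting the values of an index function gives an index function.\<close>
    have "cycle_coeff n r d i k = (0 :: 'a)" if i: "i \<in> index_functions n d" for i
      unfolding cycle_coeff_def
    proof (rule sum.neutral, intro ballI)
      fix \<sigma> assume "\<sigma> \<in> r_cycles r d"
      then have "compose {1..n} \<sigma> i \<in> index_functions n d"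
        using compose_in_index_functions[OF r_cycles_permutes i] by simp
      then show "(if compose {1..n} \<sigma> i = k then 1 else 0) = (0 :: 'a)" using False by auto
    qed
    then show ?thesis unfolding f_map_eq_matrix_coeff action_Omega using False by simp
  qed
qed

text \<open>For uniqueness, applying \<open>f_map\<close> to basis vectors reads off the matrix
  entries, and \<open>n + n \<le> d\<close> makes the matrix determine the element.\<close>

lemma omega_eq_C_elem:
  assumes "0 < r" "2 * n + r \<le> d"
  shows "omega n r (of_nat d) = (C_elem n r d :: diagram \<Rightarrow> 'a::field_char_0)"
  unfolding C_elem_def
proof (rule the_equality[symmetric])
  show "omega n r (of_nat d) \<in> (FP n n :: (diagram \<Rightarrow> 'a) set) \<and>
      (\<forall>w\<in>tensor_power n d. f_map n n d (omega n r (of_nat d)) w = action n d (Omega r d) w)"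
    by (intro conjI ballI omega_in_FP f_map_omega[OF assms])
  fix g :: "diagram \<Rightarrow> 'a"
  assume g: "g \<in> FP n n \<and> (\<forall>w\<in>tensor_power n d. f_map n n d g w = action n d (Omega r d) w)"
  have delta: "f_map n n d h (basis_vec i) k = matrix_coeff n n h i k"
    if "i \<in> index_functions n d" "k \<in> index_functions n d" for h :: "diagram \<Rightarrow> 'a" and i k
    unfolding f_map_eq_matrix_coeff basis_vec_def using that finite_index_functions[of n d]
    by (simp add: if_distrib[of "\<lambda>x. x * _"] cong: if_cong)
  show "g = omega n r (of_nat d)"
  proof (rule FP_eqI)
    show "n + n \<le> d" using assms by simp
    fix i k assume ik: "i \<in> index_functions n d" "k \<in> index_functions n d"
    then have "(basis_vec i :: _ \<Rightarrow> 'a) \<in> tensor_power n d" by (auto simp: tensor_power_def span_on_def basis_vec_def)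
    then have "f_map n n d g (basis_vec i) = f_map n n d (omega n r (of_nat d)) (basis_vec i)"
      using g f_map_omega[OF assms, where 'a = 'a] by simp
    from fun_cong[OF this, of k] show "matrix_coeff n n g i k = matrix_coeff n n (omega n r (of_nat d)) i k"
      unfolding delta[OF ik] .
  qed (use g omega_in_FP in auto)
qed

text \<open>Entries depend only on which vertices share a colour, and an injective renaming of
  colours does not affect that. This is the equivariance of the maps coming from diagrams.\<close>

lemma matrix_coeff_compose:
  assumes \<sigma>: "\<sigma> permutes {1..d}"
  shows "matrix_coeff n m g (compose {1..n} \<sigma> i) (compose {1..m} \<sigma> s) = matrix_coeff n m g i s"
proof -
  have "good_coloring \<pi> (compose {1..n} \<sigma> i) (compose {1..m} \<sigma> s) \<longleftrightarrow> good_coloring \<pi> i s"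
    if \<pi>: "\<pi> \<in> P n m" for \<pi>
  proof -
    have "part_constant \<pi> (color (compose {1..n} \<sigma> i) (compose {1..m} \<sigma> s)) \<longleftrightarrow>
        part_constant \<pi> (\<lambda>v. \<sigma> (color i s v))"
      by (rule part_constant_cong) (auto simp: Union_P[OF \<pi>] vertices_def compose_def)
    also have "\<dots> \<longleftrightarrow> part_constant \<pi> (color i s)"
      unfolding part_constant_def using permutes_inj[OF \<sigma>] by (simp add: inj_eq)
    finally show ?thesis unfolding good_coloring_eq_part_constant .
  qed
  then show ?thesis unfolding matrix_coeff_def by (intro sum.cong refl if_cong) simp_all
qed

text \<open>For each single cycle \<sigma>, the left sum collapses to the entry at \<open>i\<close>
  and the inverse image of \<open>k\<close>, the right sum to the entry at the image of
  \<open>i\<close> and \<open>k\<close>. Equivariance identifies the two.\<close>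

lemma cycle_coeff_commute:
  fixes g :: "diagram \<Rightarrow> 'a::field_char_0"
  assumes i: "i \<in> index_functions n d" and k: "k \<in> index_functions m d"
  shows "(\<Sum>s\<in>index_functions m d. matrix_coeff n m g i s * cycle_coeff m r d s k) =
    (\<Sum>s\<in>index_functions n d. cycle_coeff n r d i s * matrix_coeff n m g s k)"
proof -
  have "(\<Sum>s\<in>index_functions m d. matrix_coeff n m g i s * cycle_coeff m r d s k) =
      (\<Sum>\<sigma>\<in>r_cycles r d. \<Sum>s\<in>index_functions m d.
        matrix_coeff n m g i s * (if compose {1..m} \<sigma> s = k then 1 else 0))"
    unfolding cycle_coeff_def sum_distrib_left by (rule sum.swap)
  also have "\<dots> = (\<Sum>\<sigma>\<in>r_cycles r d. matrix_coeff n m g (compose {1..n} \<sigma> i) k)"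
  proof (rule sum.cong[OF refl])
    fix \<sigma> assume "\<sigma> \<in> r_cycles r d"
    then have \<sigma>: "\<sigma> permutes {1..d}" by (rule r_cycles_permutes)
    define s0 where "s0 = compose {1..m} (inv \<sigma>) k"
    have s0: "s0 \<in> index_functions m d"
      unfolding s0_def using permutes_inv[OF \<sigma>] k by (rule compose_in_index_functions)
    have inverses: "\<sigma> (inv \<sigma> x) = x" "inv \<sigma> (\<sigma> x) = x" for x using permutes_inverses[OF \<sigma>] by simp_all
    have ext: "s \<in> extensional {1..m}" if "s \<in> index_functions m d" for s
      using that by (simp add: index_functions_def PiE_def)
    have "compose {1..m} \<sigma> s0 = k"
      by (rule extensionalityI[of _ "{1..m}"]) (simp_all add: ext[OF k, simplified] s0_def compose_def inverses)
    moreover have "s = s0" if "s \<in> index_functions m d" "compose {1..m} \<sigma> s = k" for s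
      by (rule extensionalityI[of _ "{1..m}"])
        (simp_all add: ext[OF that(1), simplified] s0_def that(2)[symmetric] compose_def inverses)
    ultimately have "compose {1..m} \<sigma> s = k \<longleftrightarrow> s = s0" if "s \<in> index_functions m d" for s
      using that by metis
    then have "(\<Sum>s\<in>index_functions m d.
        matrix_coeff n m g i s * (if compose {1..m} \<sigma> s = k then 1 else 0)) =
        (\<Sum>s\<in>index_functions m d. if s = s0 then matrix_coeff n m g i s0 else 0)"
      by (intro sum.cong refl) simp
    also have "\<dots> = matrix_coeff n m g i s0" using s0 finite_index_functions[of m d] by simp
    also have "\<dots> = matrix_coeff n m g (compose {1..n} \<sigma> i) k"
      using matrix_coeff_compose[OF \<sigma>, of n m g i s0] \<open>compose {1..m} \<sigma> s0 = k\<close> by simp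
    finally show "(\<Sum>s\<in>index_functions m d.
        matrix_coeff n m g i s * (if compose {1..m} \<sigma> s = k then 1 else 0)) =
        matrix_coeff n m g (compose {1..n} \<sigma> i) k" .
  qed
  also have "\<dots> = (\<Sum>\<sigma>\<in>r_cycles r d. \<Sum>s\<in>index_functions n d.
      (if compose {1..n} \<sigma> i = s then 1 else 0) * matrix_coeff n m g s k)"
  proof (rule sum.cong[OF refl])
    fix \<sigma> assume "\<sigma> \<in> r_cycles r d"
    then have "compose {1..n} \<sigma> i \<in> index_functions n d"
      using compose_in_index_functions[OF r_cycles_permutes i] by simp
    then show "matrix_coeff n m g (compose {1..n} \<sigma> i) k = (\<Sum>s\<in>index_functions n d.
        (if compose {1..n} \<sigma> i = s then 1 else 0) * matrix_coeff n m g s k)"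
      using finite_index_functions[of n d] by (simp add: if_distrib[of "\<lambda>x. x * _"] cong: if_cong)
  qed
  also have "\<dots> = (\<Sum>s\<in>index_functions n d. cycle_coeff n r d i s * matrix_coeff n m g s k)"
    unfolding cycle_coeff_def sum_distrib_right by (rule sum.swap)
  finally show ?thesis .
qed

lemma Rep0_comp_in_FP: "Rep0_comp t n m l g h \<in> FP n l"
proof -
  have "Rep0_comp t n m l g h \<rho> = 0" if "\<rho> \<notin> P n l" for \<rho>
    unfolding Rep0_comp_def basis_vec_def using dot_in_P that
    by (intro sum.neutral ballI) auto
  then show ?thesis unfolding FP_def span_on_def by simp
qed

text \<open>The bound on \<open>d\<close> covers three requirements: \<open>2 * n + r\<close> and
  \<open>2 * m + r\<close> for the two matrices of \<open>omega\<close> to count cycles, and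
  \<open>n + m\<close> for comparing morphisms by their matrices.\<close>

lemma omega_commute_of_nat:
  fixes g :: "diagram \<Rightarrow> 'a::field_char_0"
  assumes "0 < r" "2 * n + 2 * m + r \<le> d"
  shows "Rep0_comp (of_nat d) n m m (omega m r (of_nat d)) g =
    Rep0_comp (of_nat d) n n m g (omega n r (of_nat d))"
proof (rule FP_eqI[OF Rep0_comp_in_FP Rep0_comp_in_FP])
  show "n + m \<le> d" using assms by simp
  have n: "2 * n + r \<le> d" and m: "2 * m + r \<le> d" using assms by simp_all
  fix i k assume ik: "i \<in> index_functions n d" "k \<in> index_functions m d"
  show "matrix_coeff n m (Rep0_comp (of_nat d) n m m (omega m r (of_nat d)) g) i k =
      matrix_coeff n m (Rep0_comp (of_nat d) n n m g (omega n r (of_nat d))) i k"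
    unfolding matrix_coeff_comp[OF ik]
    using cycle_coeff_commute[OF ik, of g r]
      matrix_coeff_omega_eq_cycle_coeff[OF _ ik(2) assms(1) m, where 'a = 'a]
      matrix_coeff_omega_eq_cycle_coeff[OF ik(1) _ assms(1) n, where 'a = 'a]
    by (simp cong: sum.cong)
qed

section \<open>From large integers to arbitrary t\<close>

definition polynomial_in :: "('a::field_char_0 \<Rightarrow> 'a) \<Rightarrow> bool" where
  "polynomial_in h \<longleftrightarrow> (\<exists>p. \<forall>t. h t = poly p t)"

lemma polynomial_in_const: "polynomial_in (\<lambda>t. c)"
  unfolding polynomial_in_def by (intro exI[of _ "[:c:]"]) simp

lemma polynomial_in_id: "polynomial_in (\<lambda>t. t)"
  unfolding polynomial_in_def by (intro exI[of _ "[:0, 1:]"]) simp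

lemma polynomial_in_add: "polynomial_in g \<Longrightarrow> polynomial_in h \<Longrightarrow> polynomial_in (\<lambda>t. g t + h t)"
  unfolding polynomial_in_def by (metis poly_add)

lemma polynomial_in_diff: "polynomial_in g \<Longrightarrow> polynomial_in h \<Longrightarrow> polynomial_in (\<lambda>t. g t - h t)"
  unfolding polynomial_in_def by (metis poly_diff)

lemma polynomial_in_mult: "polynomial_in g \<Longrightarrow> polynomial_in h \<Longrightarrow> polynomial_in (\<lambda>t. g t * h t)"
  unfolding polynomial_in_def by (metis poly_mult)

lemma polynomial_in_power: "polynomial_in g \<Longrightarrow> polynomial_in (\<lambda>t. g t ^ k)"
  unfolding polynomial_in_def by (metis poly_power)

lemma polynomial_in_sum: "(\<And>x. x \<in> A \<Longrightarrow> polynomial_in (g x)) \<Longrightarrow> polynomial_in (\<lambda>t. \<Sum>x\<in>A. g x t)"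
  by (induction A rule: infinite_finite_induct) (auto intro: polynomial_in_const polynomial_in_add)

lemma polynomial_in_prod: "(\<And>x. x \<in> A \<Longrightarrow> polynomial_in (g x)) \<Longrightarrow> polynomial_in (\<lambda>t. \<Prod>x\<in>A. g x t)"
  by (induction A rule: infinite_finite_induct) (auto intro: polynomial_in_const polynomial_in_mult)

text \<open>In characteristic zero the integers from \<open>N\<close> on are infinitely many roots
  of the difference, which must then vanish.\<close>

lemma polynomial_in_eqI:
  assumes "polynomial_in g" "polynomial_in h" and eq: "\<And>d. N \<le> d \<Longrightarrow> g (of_nat d) = h (of_nat d)"
  shows "g t = h t"
proof -
  obtain p q where p: "\<And>t. g t = poly p t" and q: "\<And>t. h t = poly q t"
    using assms(1,2) unfolding polynomial_in_def by metis
  have "infinite (of_nat ` {N..} :: 'a set)"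
    using infinite_Ici[of N] by (simp add: finite_image_iff inj_on_def)
  moreover have "of_nat ` {N..} \<subseteq> {t. poly (p - q) t = 0}" using eq p q by auto
  ultimately have "infinite {t. poly (p - q) t = 0}" using finite_subset by auto
  then have "p - q = 0" by (metis poly_roots_finite)
  then show ?thesis using p q by simp
qed

text \<open>The test that selects the branch of \<open>q_coeff\<close> does not involve
  \<open>t\<close>, so for fixed \<open>n\<close>, \<open>\<pi>\<close> and \<open>r\<close> a
  single branch is valid for all \<open>t\<close>.\<close>

lemma polynomial_in_q_coeff: "polynomial_in (\<lambda>t. q_coeff n \<pi> r t)"
proof (cases "\<forall>d>1. S_defined n \<pi> r d \<longrightarrow> S n \<pi> r d = 0")
  case True
  have "(\<lambda>t :: 'a. q_coeff n \<pi> r t) = (\<lambda>t. 0)"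
    unfolding q_coeff_def Let_def using True by (intro ext if_P)
  then show ?thesis by (simp add: polynomial_in_const)
next
  case False
  have eq: "q_coeff n \<pi> r t = fact (r + num_joined_components n \<pi> - num_parts \<pi> - 1) /
      fact (r + num_fixed_parts n \<pi> - num_parts \<pi>) *
      (\<Prod>k=1..r + num_fixed_parts n \<pi> - num_parts \<pi>. t - of_nat r - of_nat (num_fixed_parts n \<pi>) + of_nat k)"
    for t :: 'a
    unfolding q_coeff_def Let_def using False by (rule if_not_P)
  show ?thesis unfolding eq
    by (intro polynomial_in_mult polynomial_in_prod polynomial_in_add polynomial_in_diff
        polynomial_in_const polynomial_in_id)
qed

lemma polynomial_in_omega: "polynomial_in (\<lambda>t. omega n r t \<rho>)"
  unfolding omega_def
  by (intro polynomial_in_sum polynomial_in_mult polynomial_in_q_coeff polynomial_in_const)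

lemma polynomial_in_Rep0_comp:
  assumes "\<And>\<mu>. polynomial_in (\<lambda>t. g t \<mu>)" "\<And>\<pi>. polynomial_in (\<lambda>t. h t \<pi>)"
  shows "polynomial_in (\<lambda>t. Rep0_comp t n m l (g t) (h t) \<rho>)"
  unfolding Rep0_comp_def
  by (intro polynomial_in_sum polynomial_in_mult polynomial_in_power polynomial_in_id
      polynomial_in_const assms)

text \<open>With \<open>g\<close> fixed, each coefficient of both sides is polynomial in
  \<open>t\<close>, which enters through \<open>omega\<close> and through the powers counting loops;
  so agreement at large integers suffices.\<close>

lemma omega_natural:
  fixes g :: "diagram \<Rightarrow> 'a::field_char_0"
  assumes "0 < r"
  shows "Rep0_comp t n m m (omega m r t) g = Rep0_comp t n n m g (omega n r t)"
proof
  fix \<rho>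
  show "Rep0_comp t n m m (omega m r t) g \<rho> = Rep0_comp t n n m g (omega n r t) \<rho>"
  proof (rule polynomial_in_eqI[where t = t and N = "2 * n + 2 * m + r"
        and g = "\<lambda>t. Rep0_comp t n m m (omega m r t) g \<rho>"
        and h = "\<lambda>t. Rep0_comp t n n m g (omega n r t) \<rho>"])
    show "polynomial_in (\<lambda>t. Rep0_comp t n m m (omega m r t) g \<rho>)"
      by (intro polynomial_in_Rep0_comp polynomial_in_omega polynomial_in_const)
    show "polynomial_in (\<lambda>t. Rep0_comp t n n m g (omega n r t) \<rho>)"
      by (intro polynomial_in_Rep0_comp polynomial_in_omega polynomial_in_const)
  qed (simp add: omega_commute_of_nat[OF assms])
qed

theorem proposition4p6:
  shows "(\<forall>r n d::nat. 0 < r \<longrightarrow> 2 * n + r \<le> d \<longrightarrow>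
            (omega n r (of_nat d) :: diagram \<Rightarrow> 'a::field_char_0) = C_elem n r d \<and>
            (\<forall>w\<in>tensor_power n d.
               f_map n n d (omega n r (of_nat d) :: diagram \<Rightarrow> 'a) w = action n d (Omega r d) w))
       \<and> (\<forall>(t::'a) (r::nat). 0 < r \<longrightarrow>
            endomorphism_of_identity (Rep0 t) (\<lambda>n. omega n r t) \<and>
            (\<forall>n. omega n r t \<in> center_of_End (Rep0 t) n))"
proof (intro conjI allI impI)
  fix t :: 'a and r :: nat assume r: "0 < r"
  show "endomorphism_of_identity (Rep0 t) (\<lambda>n. omega n r t)"
    unfolding endomorphism_of_identity_def natural_transformation_def identity_functor_def Rep0_def
    by (simp add: omega_in_FP omega_natural[OF r])
  \<comment> \<open>Centrality is naturality with respect to endomorphisms, the case of equal source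
    and target.\<close>
  show "omega n r t \<in> center_of_End (Rep0 t) n" for n
    unfolding center_of_End_def Rep0_def by (simp add: omega_in_FP omega_natural[OF r])
qed (auto simp flip: omega_eq_C_elem intro: f_map_omega)

end
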